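(* Let $m,l$ be positive coprime integers and put \[ a=\frac{m-l}{m+l},\quad b=\frac{ml}{6},\quad c=2m,\quad d=\frac{m^3(l^2-m^2)}{180}. \] Then the continuous limit \[ u(n,t)=a+ab\,\varepsilon^2U(x+c\varepsilon t,\tau+d\varepsilon^5t),\qquad f(n,t)=1+\sum_{s=2}^\infty\varepsilon^sY_s(x+c\varepsilon t,\tau+d\varepsilon^5t),\qquad x=\varepsilon n,\quad \varepsilon\to0, \] where the $Y_s$ are the differential polynomials in $U$ determined by the first equation of the system below as described in the context, sends the system \[ u_mf_m=uf_{m+l},\qquad u_{,t}=u^2(f-f_{m+l})+f_m-f_l \] into the Sawada--Kotera equation \[ U_{,\tau}=U_5+5UU_3+5U_1U_2+5U^2U_1 . \] That is, after this substitution, as formal power series in $\varepsilon$, \[ u_{,t}-\bigl(u^2(f-f_{m+l})+f_m-f_l\bigr)=abd\,\varepsilon^7\bigl(U_{,\tau}-U_5-5UU_3-5U_1U_2-5U^2U_1\bigr)+O(\varepsilon^8). \]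
   Context: In the lattice system, $u=u(n,t)$, $f=f(n,t)$, $u_j=u(n+j,t)$, $f_j=f(n+j,t)$, $u_{,t}=\partial_tu$. For the smooth function $U=U(x,\tau)$ write $U_j=\partial_x^jU$ and $U_{,\tau}=\partial_\tau U$. Under the substitution a shift $n\mapsto n+j$ becomes $x\mapsto x+j\varepsilon$ and is expanded as a formal Taylor series in $\varepsilon$ (i.e. acts as $\exp(j\varepsilon\partial_x)$). The functions $Y_s$, $s\ge2$, are the differential polynomials in $U$ (polynomials in $U,U_1,U_2,\dots$ without constant term) obtained by substituting the ansatz into the constraint $u_mf_m=uf_{m+l}$, cancelling the common constant factor $a$, and requiring the result to hold identically at every order in $\varepsilon$, with all integration constants set to zero (the dependence on $t$ plays no role here). For instance, \[ Y_2=\frac{mb}{l}U,\quad Y_3=-\frac{m(m+l)b}{2l}U_1,\quad Y_4=\frac{m(m+l)(2m+l)b}{12l}U_2+\frac{m(m-l)b^2}{2l^2}U^2 . \] *)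

theory Defs
  imports "HOL-Analysis.Analysis" "HOL-Library.Poly_Mapping"
begin

definition dx :: "(real \<Rightarrow> real \<Rightarrow> real) \<Rightarrow> real \<Rightarrow> real \<Rightarrow> real" where
  "dx F = (\<lambda>x \<tau>. deriv (\<lambda>y. F y \<tau>) x)"

definition dtau :: "(real \<Rightarrow> real \<Rightarrow> real) \<Rightarrow> real \<Rightarrow> real \<Rightarrow> real" where
  "dtau F = (\<lambda>x \<tau>. deriv (\<lambda>s. F x s) \<tau>)"

primrec C_k :: "nat \<Rightarrow> (real \<Rightarrow> real \<Rightarrow> real) \<Rightarrow> bool" where
  "C_k 0 F \<longleftrightarrow> continuous_on UNIV (\<lambda>(x, \<tau>). F x \<tau>)"
| "C_k (Suc k) F \<longleftrightarrow>
     (\<forall>x \<tau>. (\<lambda>y. F y \<tau>) field_differentiable (at x) \<and> (\<lambda>s. F x s) field_differentiable (at \<tau>))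
     \<and> C_k k (dx F) \<and> C_k k (dtau F)"

definition smooth :: "(real \<Rightarrow> real \<Rightarrow> real) \<Rightarrow> bool" where
  "smooth F \<longleftrightarrow> (\<forall>k. C_k k F)"

(* Differential polynomials in U with real coefficients: a monomial e :: nat \<Rightarrow>\<^sub>0 nat stands
   for the product of the powers U_j ^ e(j), and a polynomial is a finitely supported family of
   coefficients of monomials; the monomial 0 carries the constant term. *)

type_synonym diffpoly = "(nat \<Rightarrow>\<^sub>0 nat) \<Rightarrow>\<^sub>0 real"

definition dp_eval :: "diffpoly \<Rightarrow> (nat \<Rightarrow> real) \<Rightarrow> real" where
  "dp_eval P v = (\<Sum>e\<in>Poly_Mapping.keys P. Poly_Mapping.lookup P e *
      (\<Prod>j\<in>Poly_Mapping.keys e. v j ^ Poly_Mapping.lookup e j))"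

definition dp_at :: "diffpoly \<Rightarrow> (real \<Rightarrow> real \<Rightarrow> real) \<Rightarrow> real \<Rightarrow> real \<Rightarrow> real" where
  "dp_at P U x \<tau> = dp_eval P (\<lambda>j. (dx ^^ j) U x \<tau>)"

(* A formal power series in epsilon (= fps_X) whose coefficients are functions of (x, tau) is
   represented pointwise. In the continuous limit these coefficients are evaluated at
   (x + c epsilon t, tau + d epsilon^5 t). *)

type_synonym fps_field = "real \<Rightarrow> real \<Rightarrow> real fps"

definition fps_dx :: "fps_field \<Rightarrow> fps_field" where
  "fps_dx F = (\<lambda>x \<tau>. Abs_fps (\<lambda>k. dx (\<lambda>y s. fps_nth (F y s) k) x \<tau>))"

definition fps_dtau :: "fps_field \<Rightarrow> fps_field" where
  "fps_dtau F = (\<lambda>x \<tau>. Abs_fps (\<lambda>k. dtau (\<lambda>y s. fps_nth (F y s) k) x \<tau>))"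

(* The shift n \<mapsto> n + j, that is exp (j epsilon d/dx). *)
definition shift :: "nat \<Rightarrow> fps_field \<Rightarrow> fps_field" where
  "shift j F = (\<lambda>x \<tau>. Abs_fps (\<lambda>k. \<Sum>i\<le>k. real j ^ i / fact i * fps_nth ((fps_dx ^^ i) F x \<tau>) (k - i)))"

(* The derivative with respect to t of a field evaluated at (x + c epsilon t, tau + d epsilon^5 t);
   see lemma chain_rule_t below. *)
definition dt :: "real \<Rightarrow> real \<Rightarrow> fps_field \<Rightarrow> fps_field" where
  "dt c d F = (\<lambda>x \<tau>. fps_const c * fps_X * fps_dx F x \<tau> + fps_const d * fps_X ^ 5 * fps_dtau F x \<tau>)"

definition lattice_u :: "real \<Rightarrow> real \<Rightarrow> (real \<Rightarrow> real \<Rightarrow> real) \<Rightarrow> fps_field" where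
  "lattice_u a b U = (\<lambda>x \<tau>. fps_const a + fps_const (a * b * U x \<tau>) * fps_X ^ 2)"

definition lattice_f :: "(nat \<Rightarrow> diffpoly) \<Rightarrow> (real \<Rightarrow> real \<Rightarrow> real) \<Rightarrow> fps_field" where
  "lattice_f Y U = (\<lambda>x \<tau>. 1 + Abs_fps (\<lambda>s. if s \<ge> 2 then dp_at (Y s) U x \<tau> else 0))"

(* The differential polynomials Y s, s \<ge> 2, solve the constraint u_m f_m = u f_(m+l) identically
   in U. Cancelling the factor a in lattice_u a b U = a * lattice_u 1 b U leaves the equation for
   lattice_u 1 b U, which is meaningful also when a = 0. The unused entries Y 0 and Y 1 are set to
   zero, and vanishing constant terms express vanishing integration constants. *)
definition constraint_ansatz :: "nat \<Rightarrow> nat \<Rightarrow> real \<Rightarrow> (nat \<Rightarrow> diffpoly) \<Rightarrow> bool" where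
  "constraint_ansatz m l b Y \<longleftrightarrow>
     Y 0 = 0 \<and> Y 1 = 0 \<and> (\<forall>s\<ge>2. Poly_Mapping.lookup (Y s) 0 = 0) \<and>
     (\<forall>U. smooth U \<longrightarrow> (\<forall>x \<tau>.
        shift m (lattice_u 1 b U) x \<tau> * shift m (lattice_f Y U) x \<tau>
        = lattice_u 1 b U x \<tau> * shift (m + l) (lattice_f Y U) x \<tau>))"

lemma chain_rule_t:
  assumes "smooth F"
  shows "((\<lambda>t. F (x + c * \<epsilon> * t) (\<tau> + d * \<epsilon> ^ 5 * t)) has_real_derivative
      c * \<epsilon> * dx F (x + c * \<epsilon> * t) (\<tau> + d * \<epsilon> ^ 5 * t)
      + d * \<epsilon> ^ 5 * dtau F (x + c * \<epsilon> * t) (\<tau> + d * \<epsilon> ^ 5 * t)) (at t)"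
proof -
  have 1: "C_k (Suc 0) F" using assms by (auto simp: smooth_def)
  let ?X = "x + c * \<epsilon> * t" and ?T = "\<tau> + d * \<epsilon> ^ 5 * t"
  have x: "((\<lambda>y. F y s) has_real_derivative dx F y s) (at y)" for y s
    using 1 by (simp add: dx_def DERIV_deriv_iff_field_differentiable)
  have t: "((\<lambda>s. F y s) has_real_derivative dtau F y s) (at s)" for y s
    using 1 by (simp add: dtau_def DERIV_deriv_iff_field_differentiable)
  have "continuous_on UNIV (\<lambda>(y, s). dtau F y s)" using 1 by simp
  then have "continuous_on UNIV (\<lambda>(y, s). blinfun_mult_right (dtau F y s))"
    unfolding case_prod_unfold
    by (rule bounded_linear.continuous_on[OF bounded_linear_blinfun_mult_right])
  then have c: "continuous (at (?X, ?T) within UNIV \<times> UNIV)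
      (\<lambda>(y, s). blinfun_mult_right (dtau F y s))"
    by (simp add: continuous_on_eq_continuous_at)
  have "((\<lambda>(y, s). F y s) has_derivative
      (\<lambda>(h, k). dx F ?X ?T * h + blinfun_mult_right (dtau F ?X ?T) k))
      (at (?X, ?T) within UNIV \<times> UNIV)"
    by (rule has_derivative_partialsI[OF _ _ c])
       (use x t in \<open>auto simp: has_field_derivative_def\<close>)
  then have D: "((\<lambda>(y, s). F y s) has_derivative
      (\<lambda>(h, k). dx F ?X ?T * h + dtau F ?X ?T * k)) (at (?X, ?T))"
    by simp
  have G: "((\<lambda>t. (x + c * \<epsilon> * t, \<tau> + d * \<epsilon> ^ 5 * t)) has_derivative
      (\<lambda>h. (c * \<epsilon> * h, d * \<epsilon> ^ 5 * h))) (at t)"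
    by (auto intro!: derivative_eq_intros)
  let ?D = "c * \<epsilon> * dx F ?X ?T + d * \<epsilon> ^ 5 * dtau F ?X ?T"
  have "(\<lambda>h. dx F ?X ?T * (c * \<epsilon> * h) + dtau F ?X ?T * (d * \<epsilon> ^ 5 * h)) = (*) ?D"
    by (simp add: fun_eq_iff algebra_simps)
  then show ?thesis
    using has_derivative_compose[OF G D] by (simp add: has_field_derivative_def)
qed

end

theory Submission
  imports Defs
begin

text \<open>All fields are formal power series in \<open>\<epsilon>\<close> over the differential polynomials, on which the
  shift by \<open>j\<close> is the ring automorphism \<open>exp (j \<epsilon> D)\<close> with \<open>D\<close> the total derivative. Let \<open>v\<close> be
  \<open>u\<close> without its factor \<open>a\<close>. As \<open>l\<close> is invertible, \<open>p p\<^sub>1 \<dots> p\<^bsub>l-1\<^esub> = v\<close> can be solved for \<open>p\<close>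
  order by order; then \<open>f\<^sub>m = p p\<^sub>1 \<dots> p\<^bsub>m-1\<^esub>\<close> solves the constraint without any integration.
  Two solutions differ, at the lowest order, by a differential polynomial that is killed by \<open>D\<close>
  and has no constant term, hence vanishes. In the evolution equation \<open>Y\<^sub>7\<close> cancels up to order 7,
  and \<open>Y\<^sub>5\<close>, \<open>Y\<^sub>6\<close> enter only through their derivatives, which the constraint at orders 6 and 7
  provides directly.\<close>

subsection \<open>Smooth fields\<close>

lemma C_k_const: "C_k k (\<lambda>x \<tau>. r)"
proof (induction k arbitrary: r)
  case (Suc k)
  have "dx (\<lambda>x \<tau>. r) = (\<lambda>x \<tau>. 0)" "dtau (\<lambda>x \<tau>. r) = (\<lambda>x \<tau>. 0)"
    by (simp_all add: dx_def dtau_def)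
  with Suc show ?case by simp
qed simp

lemma smooth_dx: "smooth F \<Longrightarrow> smooth (dx F)"
  unfolding smooth_def by (metis C_k.simps(2))

lemma smooth_dx_pow: "smooth F \<Longrightarrow> smooth ((dx ^^ j) F)"
  by (induction j) (auto intro: smooth_dx)

lemma smooth_has_dx:
  assumes "smooth F" shows "((\<lambda>y. F y \<tau>) has_real_derivative dx F x \<tau>) (at x)"
proof -
  have "C_k (Suc 0) F" using assms by (auto simp: smooth_def)
  then show ?thesis by (simp add: dx_def DERIV_deriv_iff_field_differentiable)
qed

lemma smooth_has_dtau:
  assumes "smooth F" shows "((\<lambda>s. F x s) has_real_derivative dtau F x \<tau>) (at \<tau>)"
proof -
  have "C_k (Suc 0) F" using assms by (auto simp: smooth_def)
  then show ?thesis by (simp add: dtau_def DERIV_deriv_iff_field_differentiable)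
qed

lemma dx_poly: "dx (\<lambda>x \<tau>. poly p x) = (\<lambda>x \<tau>. poly (pderiv p) x)"
  by (simp add: dx_def fun_eq_iff DERIV_imp_deriv poly_DERIV)

lemma dx_pow_poly: "(dx ^^ j) (\<lambda>x \<tau>. poly p x) = (\<lambda>x \<tau>. poly ((pderiv ^^ j) p) x)"
  by (induction j) (simp_all add: dx_poly)

text \<open>Polynomials in \<open>x\<close> alone serve as test fields: they realise every finite
  jet, so identities valid for all smooth fields can be tested on them.\<close>

lemma smooth_poly: "smooth (\<lambda>x \<tau>. poly p x)"
proof -
  have "C_k k (\<lambda>x \<tau>. poly p x)" for k
  proof (induction k arbitrary: p)
    case 0
    show ?case by (simp add: case_prod_unfold) (intro continuous_intros)
  next
    case (Suc k)
    have "dtau (\<lambda>x \<tau>. poly p x) = (\<lambda>x \<tau>. 0)" by (simp add: dtau_def)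
    moreover have "(\<lambda>y. poly p y) field_differentiable at x" for x
      using poly_DERIV field_differentiable_def by blast
    ultimately show ?case using Suc by (simp add: dx_poly C_k_const)
  qed
  then show ?thesis by (simp add: smooth_def)
qed

subsection \<open>Evaluation of differential polynomials\<close>

definition dp_const :: "real \<Rightarrow> diffpoly" where
  "dp_const r = Poly_Mapping.single 0 r"

definition dp_var :: "nat \<Rightarrow> diffpoly" where
  "dp_var j = Poly_Mapping.single (Poly_Mapping.single j 1) 1"

definition dp_mono :: "(nat \<Rightarrow>\<^sub>0 nat) \<Rightarrow> (nat \<Rightarrow> real) \<Rightarrow> real" where
  "dp_mono e v = (\<Prod>j\<in>Poly_Mapping.keys e. v j ^ Poly_Mapping.lookup e j)"

lemma dp_mono_superset:
  assumes "finite S" "Poly_Mapping.keys e \<subseteq> S"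
  shows "dp_mono e v = (\<Prod>j\<in>S. v j ^ Poly_Mapping.lookup e j)"
  unfolding dp_mono_def using assms by (intro prod.mono_neutral_left) (auto simp: in_keys_iff)

lemma dp_mono_zero [simp]: "dp_mono 0 v = 1"
  by (simp add: dp_mono_def)

lemma dp_mono_one [simp]: "dp_mono e (\<lambda>j. 1) = 1"
  by (simp add: dp_mono_def)

lemma dp_mono_at_zero: "dp_mono e (\<lambda>j. 0) = (if e = 0 then 1 else 0)"
proof (cases "e = 0")
  case False
  then obtain j where "j \<in> Poly_Mapping.keys e" by (metis ex_in_conv keys_eq_empty)
  then have "\<exists>j\<in>Poly_Mapping.keys e. (0::real) ^ Poly_Mapping.lookup e j = 0"
    by (auto simp: in_keys_iff)
  with False show ?thesis by (simp add: dp_mono_def)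
qed simp

lemma dp_mono_add: "dp_mono (e + e') v = dp_mono e v * dp_mono e' v"
proof -
  let ?S = "Poly_Mapping.keys e \<union> Poly_Mapping.keys e'"
  have "dp_mono (e + e') v = (\<Prod>j\<in>?S. v j ^ Poly_Mapping.lookup (e + e') j)"
    by (intro dp_mono_superset keys_add) simp
  also have "\<dots> = (\<Prod>j\<in>?S. v j ^ Poly_Mapping.lookup e j) * (\<Prod>j\<in>?S. v j ^ Poly_Mapping.lookup e' j)"
    by (simp add: lookup_add power_add prod.distrib)
  finally show ?thesis by (simp add: dp_mono_superset[of ?S])
qed

text \<open>Multiplicativity in the jet makes \<open>dp_mono e\<close> a character, which is what
  linear independence of the monomials rests on.\<close>

lemma dp_mono_mult: "dp_mono e (\<lambda>j. v j * w j) = dp_mono e v * dp_mono e w"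
  by (simp add: dp_mono_def power_mult_distrib prod.distrib)

lemma dp_eval_mono: "dp_eval P v = (\<Sum>e\<in>Poly_Mapping.keys P. Poly_Mapping.lookup P e * dp_mono e v)"
  by (simp add: dp_eval_def dp_mono_def)

lemma dp_eval_superset:
  assumes "finite S" "Poly_Mapping.keys P \<subseteq> S"
  shows "dp_eval P v = (\<Sum>e\<in>S. Poly_Mapping.lookup P e * dp_mono e v)"
  unfolding dp_eval_mono using assms by (intro sum.mono_neutral_left) (auto simp: in_keys_iff)

lemma dp_eval_zero [simp]: "dp_eval 0 v = 0"
  by (simp add: dp_eval_mono)

lemma dp_eval_add [simp]: "dp_eval (P + Q) v = dp_eval P v + dp_eval Q v"
proof -
  let ?S = "Poly_Mapping.keys P \<union> Poly_Mapping.keys Q"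
  have "dp_eval (P + Q) v = (\<Sum>e\<in>?S. Poly_Mapping.lookup (P + Q) e * dp_mono e v)"
    by (intro dp_eval_superset keys_add) simp
  then show ?thesis
    by (simp add: lookup_add distrib_right sum.distrib dp_eval_superset[of ?S])
qed

lemma dp_eval_sum [simp]: "dp_eval (\<Sum>i\<in>I. P i) v = (\<Sum>i\<in>I. dp_eval (P i) v)"
  by (induction I rule: infinite_finite_induct) auto

lemma dp_eval_single [simp]: "dp_eval (Poly_Mapping.single e r) v = r * dp_mono e v"
  by (simp add: dp_eval_mono)

lemma dp_sum_monomials:
  "P = (\<Sum>e\<in>Poly_Mapping.keys P. Poly_Mapping.single e (Poly_Mapping.lookup P e))" for P :: diffpoly
  by (rule poly_mapping_eqI) (simp add: lookup_sum lookup_single when_def in_keys_iff)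

lemma dp_eval_mult [simp]: "dp_eval (P * Q) v = dp_eval P v * dp_eval Q v"
proof -
  let ?p = "Poly_Mapping.lookup P" and ?q = "Poly_Mapping.lookup Q"
  have "P * Q = (\<Sum>e\<in>Poly_Mapping.keys P. Poly_Mapping.single e (?p e))
      * (\<Sum>e\<in>Poly_Mapping.keys Q. Poly_Mapping.single e (?q e))"
    using dp_sum_monomials by metis
  also have "dp_eval \<dots> v = (\<Sum>e\<in>Poly_Mapping.keys P. \<Sum>e'\<in>Poly_Mapping.keys Q.
      (?p e * dp_mono e v) * (?q e' * dp_mono e' v))"
    by (simp add: sum_product mult_single dp_mono_add mult_ac)
  finally show ?thesis by (simp add: dp_eval_mono sum_product)
qed

lemma dp_eval_const [simp]: "dp_eval (dp_const r) v = r"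
  by (simp add: dp_const_def)

lemma dp_eval_one [simp]: "dp_eval 1 v = 1"
  by (simp flip: single_one)

lemma dp_eval_var [simp]: "dp_eval (dp_var j) v = v j"
  by (simp add: dp_var_def dp_mono_def)

lemma dp_eval_minus [simp]: "dp_eval (- P) v = - dp_eval P v"
  using dp_eval_add[of P "- P" v] by simp

lemma dp_eval_diff [simp]: "dp_eval (P - Q) v = dp_eval P v - dp_eval Q v"
  using dp_eval_add[of P "- Q" v] by simp

lemma dp_eval_power [simp]: "dp_eval (P ^ n) v = dp_eval P v ^ n"
  by (induction n) auto

lemma dp_eval_prod [simp]: "dp_eval (\<Prod>i\<in>I. P i) v = (\<Prod>i\<in>I. dp_eval (P i) v)"
  by (induction I rule: infinite_finite_induct) auto

lemma dp_eval_of_nat [simp]: "dp_eval (of_nat n) v = of_nat n"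
  by (induction n) auto

lemma dp_eval_numeral [simp]: "dp_eval (numeral n) v = numeral n"
  by (metis dp_eval_of_nat of_nat_numeral)

text \<open>At the zero jet only the monomial \<open>0\<close> survives, so the condition of
  vanishing integration constants becomes a condition on a value.\<close>

lemma dp_eval_at_zero: "dp_eval P (\<lambda>j. 0) = Poly_Mapping.lookup P 0"
  by (simp add: dp_eval_mono dp_mono_at_zero in_keys_iff if_distrib cong: if_cong)

lemma dp_const_simps [simp]:
  "dp_const 0 = 0" "dp_const 1 = 1"
  "dp_const (r + s) = dp_const r + dp_const s" "dp_const (- r) = - dp_const r"
  "dp_const (r - s) = dp_const r - dp_const s" "dp_const (r * s) = dp_const r * dp_const s"
  by (simp_all add: dp_const_def single_add single_uminus single_diff mult_single)

lemma dp_const_eq_0_iff [simp]: "dp_const r = 0 \<longleftrightarrow> r = 0"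
  by (metis dp_const_simps(1) dp_eval_const)

lemma dp_const_of_nat: "dp_const (of_nat n) = of_nat n"
  by (simp add: dp_const_def)

section \<open>Linear independence of monomials\<close>

lemma dp_mono_distinct:
  assumes "e \<noteq> e'" obtains w where "dp_mono e w \<noteq> dp_mono e' w"
proof -
  obtain j where j: "Poly_Mapping.lookup e j \<noteq> Poly_Mapping.lookup e' j"
    using assms by (metis poly_mapping_eqI)
  \<comment> \<open>Doubling one variable whose exponents differ and setting all others to one turns
    the two monomials into different powers of two.\<close>
  define w where "w = (\<lambda>i. if i = j then 2 else 1 :: real)"
  have "dp_mono e w = 2 ^ Poly_Mapping.lookup e j" for e
  proof -
    have "dp_mono e w = (\<Prod>i\<in>insert j (Poly_Mapping.keys e). w i ^ Poly_Mapping.lookup e i)"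
      by (rule dp_mono_superset) auto
    also have "\<dots> = w j ^ Poly_Mapping.lookup e j
        * (\<Prod>i\<in>Poly_Mapping.keys e - {j}. w i ^ Poly_Mapping.lookup e i)"
      by (rule prod.insert_remove) simp
    also have "\<dots> = 2 ^ Poly_Mapping.lookup e j"
      by (simp add: w_def)
    finally show ?thesis .
  qed
  with j that show thesis by (metis one_less_numeral_iff power_inject_exp semiring_norm(76))
qed

text \<open>Dedekind's independence of characters, applied to the multiplicative maps \<open>dp_mono e\<close>.\<close>
lemma dp_mono_independent:
  assumes "finite S" "\<And>v. (\<Sum>e\<in>S. r e * dp_mono e v) = 0" "e \<in> S"
  shows "r e = 0"
  using assms
proof (induction S arbitrary: r e rule: finite_induct)
  case (insert e0 S)
  have *: "r e1 = 0" if "e1 \<in> S" for e1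
  proof -
    have "e1 \<noteq> e0" using insert that by auto
    then obtain w where w: "dp_mono e1 w \<noteq> dp_mono e0 w" by (rule dp_mono_distinct)
    have "(\<Sum>e\<in>S. r e * (dp_mono e w - dp_mono e0 w) * dp_mono e v) = 0" for v
    proof -
      \<comment> \<open>Evaluating the relation at the pointwise product of \<open>w\<close> and
        \<open>v\<close> and subtracting \<open>dp_mono e0 w\<close> times the relation at
        \<open>v\<close> removes the term of \<open>e0\<close>.\<close>
      have "0 = (\<Sum>e\<in>insert e0 S. r e * dp_mono e (\<lambda>j. w j * v j))
          - dp_mono e0 w * (\<Sum>e\<in>insert e0 S. r e * dp_mono e v)"
        using insert.prems(1) by simp
      also have "\<dots> = (\<Sum>e\<in>insert e0 S. r e * (dp_mono e w - dp_mono e0 w) * dp_mono e v)"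
        by (simp only: dp_mono_mult sum_distrib_left flip: sum_subtractf) (simp add: algebra_simps)
      finally show ?thesis using insert.hyps by simp
    qed
    from insert.IH[OF this that] w show ?thesis by simp
  qed
  moreover have "r e0 = 0"
    using insert.prems(1)[of "\<lambda>j. 1"] insert.hyps * by simp
  ultimately show ?case using insert.prems by auto
qed simp

lemma dp_eval_inject: "(\<And>v. dp_eval P v = 0) \<Longrightarrow> P = 0"
  using dp_mono_independent[of "Poly_Mapping.keys P" "Poly_Mapping.lookup P"]
  by (metis dp_eval_mono finite_keys in_keys_iff lookup_zero poly_mapping_eqI)

section \<open>Polynomial fields with prescribed jets\<close>

lemma dp_eval_local:
  obtains N where "\<And>v w. (\<And>j. j \<le> N \<Longrightarrow> v j = w j) \<Longrightarrow> dp_eval P v = dp_eval P w"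
proof -
  \<comment> \<open>Only finitely many jet variables occur in \<open>P\<close>; \<open>N\<close>
    will bound their indices.\<close>
  have fin: "finite (\<Union>e\<in>Poly_Mapping.keys P. Poly_Mapping.keys e)" by simp
  then obtain N where N: "\<And>j. j \<in> (\<Union>e\<in>Poly_Mapping.keys P. Poly_Mapping.keys e) \<Longrightarrow> j \<le> N"
    by (metis finite_nat_set_iff_bounded_le)
  show thesis
  proof (rule that)
    fix v w :: "nat \<Rightarrow> real" assume *: "\<And>j. j \<le> N \<Longrightarrow> v j = w j"
    show "dp_eval P v = dp_eval P w"
      unfolding dp_eval_def using N *
      by (intro sum.cong prod.cong refl arg_cong2[of _ _ _ _ "(*)"]
            arg_cong2[of _ _ _ _ "(^)"]) blast
  qed
qed

text \<open>Each differentiation lowers the multiplicity of the root \<open>z\<close> by at most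
  one.\<close>

lemma higher_pderiv_dvd: "[:- z, 1:] ^ (n + j) dvd p \<Longrightarrow> [:- z, 1:] ^ n dvd (pderiv ^^ j) p"
  for p :: "real poly"
proof (induction j arbitrary: n)
  case (Suc j)
  have "[:- z, 1:] ^ Suc n dvd (pderiv ^^ j) p"
    using Suc.IH[of "Suc n"] Suc.prems by (simp only: add_Suc add_Suc_right)
  then obtain q where "(pderiv ^^ j) p = [:- z, 1:] ^ Suc n * q" by (elim dvdE)
  then have "(pderiv ^^ Suc j) p = [:- z, 1:] ^ Suc n * pderiv q
      + smult (of_nat (Suc n)) ([:- z, 1:] ^ n) * q"
    by (simp add: pderiv_mult pderiv_power_Suc pderiv_pCons mult.commute del: power_Suc)
  then show ?case
    by (metis dvd_add dvd_mult2 dvd_refl dvd_smult mult_smult_left power_Suc2)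
qed simp

lemma poly_higher_pderiv_at_0: "poly ((pderiv ^^ j) p) 0 = fact j * coeff p j" for p :: "real poly"
  by (simp add: poly_0_coeff_0 coeff_higher_pderiv pochhammer_fact)

text \<open>The factor \<open>q\<close>, the power \<open>N + 1\<close> of \<open>x - 1\<close>,
  forces the zero jet at 1. It is invertible as a power series at 0, so the prescribed Taylor series
  can be divided by it; with \<open>r\<close> the truncation of the quotient, \<open>q * r\<close>
  has the required jet at 0.\<close>

lemma hermite_interpolation:
  obtains p :: "real poly"
  where "\<And>j. j \<le> N \<Longrightarrow> poly ((pderiv ^^ j) p) 0 = v j"
    and "\<And>j. j \<le> N \<Longrightarrow> poly ((pderiv ^^ j) p) 1 = 0"
proof -
  define q :: "real poly" where "q = [:- 1, 1:] ^ Suc N"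
  define w where "w = Abs_fps (\<lambda>j. v j / fact j) * inverse (fps_of_poly q)"
  define r where "r = (\<Sum>i\<le>N. monom (fps_nth w i) i)"
  have r: "coeff r j = fps_nth w j" if "j \<le> N" for j
    using that by (simp add: r_def coeff_sum)
  have "coeff q 0 = (- 1) ^ Suc N"
    by (simp add: q_def flip: poly_0_coeff_0)
  then have "fps_nth (fps_of_poly q) 0 \<noteq> 0" by simp
  then have w: "fps_of_poly q * w = Abs_fps (\<lambda>j. v j / fact j)"
    by (simp add: w_def inverse_mult_eq_1' mult.left_commute)
  have "coeff (q * r) j = v j / fact j" if "j \<le> N" for j
  proof -
    have "coeff (q * r) j = (\<Sum>i\<le>j. coeff q i * fps_nth w (j - i))"
      using that by (simp add: coeff_mult r)
    also have "\<dots> = fps_nth (fps_of_poly q * w) j"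
      by (simp add: fps_mult_nth atLeast0AtMost)
    finally show ?thesis by (simp add: w)
  qed
  moreover have "poly ((pderiv ^^ j) (q * r)) 1 = 0" if "j \<le> N" for j
  proof -
    have "[:- 1, 1:] ^ (Suc (N - j) + j) dvd q * r"
      using that by (simp add: q_def del: power_Suc)
    then have "[:- 1, 1:] ^ Suc (N - j) dvd (pderiv ^^ j) (q * r)"
      by (rule higher_pderiv_dvd)
    then show ?thesis by (auto elim!: dvdE)
  qed
  ultimately show thesis
    by (intro that[of "q * r"]) (simp_all add: poly_higher_pderiv_at_0)
qed

lemma dp_eval_jets:
  obtains p :: "real poly"
  where "dp_at P (\<lambda>x \<tau>. poly p x) 0 \<tau> = dp_eval P v"
      "dp_at P (\<lambda>x \<tau>. poly p x) 1 \<tau> = Poly_Mapping.lookup P 0"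
proof -
  obtain N where N: "\<And>v w. (\<And>j. j \<le> N \<Longrightarrow> v j = w j) \<Longrightarrow> dp_eval P v = dp_eval P w"
    using dp_eval_local[of P] by metis
  obtain p :: "real poly" where "\<And>j. j \<le> N \<Longrightarrow> poly ((pderiv ^^ j) p) 0 = v j"
      "\<And>j. j \<le> N \<Longrightarrow> poly ((pderiv ^^ j) p) 1 = 0"
    using hermite_interpolation[of N v] by metis
  then have "dp_at P (\<lambda>x \<tau>. poly p x) 0 \<tau> = dp_eval P v"
    "dp_at P (\<lambda>x \<tau>. poly p x) 1 \<tau> = dp_eval P (\<lambda>j. 0)"
    unfolding dp_at_def dx_pow_poly by (intro N; simp)+
  then show thesis using that by (simp add: dp_eval_at_zero)
qed

text \<open>Polynomial fields realise every jet as far as \<open>P - Q\<close> sees it, and the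
  values on all jets determine a differential polynomial. Analytic identities for all smooth fields
  thus become algebraic ones.\<close>

lemma dp_at_inject:
  assumes "\<And>U x \<tau>. smooth U \<Longrightarrow> dp_at P U x \<tau> = dp_at Q U x \<tau>"
  shows "P = Q"
proof -
  have "dp_eval (P - Q) v = 0" for v
    using assms[OF smooth_poly] dp_eval_jets[of "P - Q" _ v]
    by (metis cancel_comm_monoid_add_class.diff_cancel dp_at_def dp_eval_diff)
  then show ?thesis using dp_eval_inject[of "P - Q"] by simp
qed

subsection \<open>The total derivative\<close>

text \<open>The Leibniz formula in the shape that the differentiation rules for sums, products and
  powers produce. The algebraic laws of \<open>dp_D\<close> are derived from derivatives of fields,
  not from this formula.\<close>

definition dp_D :: "diffpoly \<Rightarrow> diffpoly" where
  "dp_D P = (\<Sum>e\<in>Poly_Mapping.keys P. dp_const (Poly_Mapping.lookup P e) *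
     (\<Sum>j\<in>Poly_Mapping.keys e. of_nat (Poly_Mapping.lookup e j) *
        dp_var j ^ (Poly_Mapping.lookup e j - 1) * dp_var (Suc j) *
        (\<Prod>i\<in>Poly_Mapping.keys e - {j}. dp_var i ^ Poly_Mapping.lookup e i)))"

lemma dp_at_has_derivative:
  assumes "smooth U"
  shows "((\<lambda>y. dp_at P U y \<tau>) has_real_derivative dp_at (dp_D P) U x \<tau>) (at x)"
proof -
  have "((\<lambda>y. (dx ^^ j) U y \<tau>) has_real_derivative (dx ^^ Suc j) U x \<tau>) (at x)" for j
    using smooth_has_dx[OF smooth_dx_pow[OF assms]] by simp
  note [derivative_intros] = this[THEN DERIV_power] has_field_derivative_prod
  show ?thesis
    unfolding dp_at_def dp_eval_def[of P]
    by (rule derivative_eq_intros refl)+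
      (simp add: dp_D_def mult_ac)
qed

lemma dx_dp_at: "smooth U \<Longrightarrow> dx (dp_at P U) = dp_at (dp_D P) U"
  by (simp add: dx_def fun_eq_iff DERIV_imp_deriv[OF dp_at_has_derivative])

lemma dp_at_simps [simp]:
  "dp_at 0 U x \<tau> = 0" "dp_at 1 U x \<tau> = 1" "dp_at (dp_const r) U x \<tau> = r"
  "dp_at (dp_var j) U x \<tau> = (dx ^^ j) U x \<tau>"
  "dp_at (P + Q) U x \<tau> = dp_at P U x \<tau> + dp_at Q U x \<tau>"
  "dp_at (P - Q) U x \<tau> = dp_at P U x \<tau> - dp_at Q U x \<tau>"
  "dp_at (- P) U x \<tau> = - dp_at P U x \<tau>"
  "dp_at (P * Q) U x \<tau> = dp_at P U x \<tau> * dp_at Q U x \<tau>"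
  "dp_at (P ^ n) U x \<tau> = dp_at P U x \<tau> ^ n"
  "dp_at (sum f I) U x \<tau> = (\<Sum>i\<in>I. dp_at (f i) U x \<tau>)"
  "dp_at (numeral k) U x \<tau> = numeral k"
  "dp_at (of_nat n) U x \<tau> = of_nat n"
  by (simp_all add: dp_at_def)

text \<open>Derivatives are unique and smooth fields separate differential polynomials, so the rules
  of calculus carry over to \<open>dp_D\<close>.\<close>

lemma dp_D_eqI:
  assumes "\<And>U x \<tau>. smooth U \<Longrightarrow> ((\<lambda>y. dp_at P U y \<tau>) has_real_derivative dp_at Q U x \<tau>) (at x)"
  shows "dp_D P = Q"
  by (rule dp_at_inject) (rule DERIV_unique[OF dp_at_has_derivative assms])

lemma dp_D_add [simp]: "dp_D (P + Q) = dp_D P + dp_D Q"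
  by (rule dp_D_eqI) (auto intro!: derivative_eq_intros dp_at_has_derivative)

lemma dp_D_mult [simp]: "dp_D (P * Q) = dp_D P * Q + P * dp_D Q"
  by (rule dp_D_eqI) (auto intro!: derivative_eq_intros dp_at_has_derivative)

lemma dp_D_const [simp]: "dp_D (dp_const r) = 0"
  by (rule dp_D_eqI) (auto intro!: derivative_eq_intros)

lemma dp_D_var [simp]: "dp_D (dp_var j) = dp_var (Suc j)"
  using smooth_has_dx[OF smooth_dx_pow] by (intro dp_D_eqI) simp

lemma dp_D_minus [simp]: "dp_D (- P) = - dp_D P"
  by (rule dp_D_eqI) (auto intro!: derivative_eq_intros dp_at_has_derivative)

lemma dp_D_diff [simp]: "dp_D (P - Q) = dp_D P - dp_D Q"
  using dp_D_add[of P "- Q"] by simp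

lemma dp_D_zero [simp]: "dp_D 0 = 0" and dp_D_one [simp]: "dp_D 1 = 0"
  using dp_D_const[of 0] dp_D_const[of 1] by simp_all

lemma dp_D_of_nat [simp]: "dp_D (of_nat n) = 0"
  by (induction n) simp_all

lemma dp_D_numeral [simp]: "dp_D (numeral n) = 0"
  by (metis dp_D_of_nat of_nat_numeral)

lemma dp_D_sum [simp]: "dp_D (sum f I) = (\<Sum>i\<in>I. dp_D (f i))"
  by (induction I rule: infinite_finite_induct) simp_all

text \<open>A polynomial field can have any given jet at \<open>0\<close> and zero jet at \<open>1\<close>, so a value that is
  constant in \<open>x\<close> equals the constant term.\<close>
lemma dp_D_kernel:
  assumes "dp_D P = 0" "Poly_Mapping.lookup P 0 = 0"
  shows "P = 0"
proof (rule dp_eval_inject)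
  fix v
  obtain p :: "real poly" where p: "dp_at P (\<lambda>x \<tau>. poly p x) 0 0 = dp_eval P v"
      "dp_at P (\<lambda>x \<tau>. poly p x) 1 0 = Poly_Mapping.lookup P 0"
    by (rule dp_eval_jets)
  have "((\<lambda>y. dp_at P (\<lambda>x \<tau>. poly p x) y 0) has_real_derivative 0) (at x)" for x
    using dp_at_has_derivative[OF smooth_poly, of P p 0 x] assms(1) by simp
  then have "dp_at P (\<lambda>x \<tau>. poly p x) 0 0 = dp_at P (\<lambda>x \<tau>. poly p x) 1 0"
    by (intro DERIV_isconst_all) blast
  with p assms(2) show "dp_eval P v = 0" by simp
qed

text \<open>Every summand of a total derivative has a factor \<open>dp_var (Suc j)\<close>, which
  vanishes at the zero jet.\<close>

lemma lookup_dp_D_zero: "Poly_Mapping.lookup (dp_D P) 0 = 0"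
proof -
  have "(\<Sum>j\<in>Poly_Mapping.keys e. f j * g j * dp_eval (dp_var (Suc j)) (\<lambda>j. 0) * h j) = 0"
    for e :: "nat \<Rightarrow>\<^sub>0 nat" and f g h
    by simp
  then show ?thesis by (simp add: dp_D_def flip: dp_eval_at_zero)
qed

subsection \<open>The shift as a formal exponential\<close>

lemma dp_D_pow_add: "(dp_D ^^ i) (P + Q) = (dp_D ^^ i) P + (dp_D ^^ i) Q"
  by (induction i) simp_all

lemma dp_D_pow_const_mult: "(dp_D ^^ i) (dp_const r * P) = dp_const r * (dp_D ^^ i) P"
  by (induction i) simp_all

lemma dp_D_pow_of_nat_mult: "(dp_D ^^ i) (of_nat n * P) = of_nat n * (dp_D ^^ i) P"
  by (induction i) simp_all

lemma dp_D_pow_zero [simp]: "(dp_D ^^ i) 0 = 0"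
  by (induction i) simp_all

lemma dp_D_pow_one: "(dp_D ^^ i) 1 = (if i = 0 then 1 else 0)"
  by (induction i) simp_all

definition fps_D :: "diffpoly fps \<Rightarrow> diffpoly fps" where
  "fps_D F = Abs_fps (\<lambda>k. dp_D (fps_nth F k))"

lemma fps_D_nth [simp]: "fps_nth (fps_D F) k = dp_D (fps_nth F k)"
  by (simp add: fps_D_def)

lemma fps_D_pow_nth: "fps_nth ((fps_D ^^ i) F) k = (dp_D ^^ i) (fps_nth F k)"
  by (induction i) simp_all

lemma fps_D_mult: "fps_D (F * G) = fps_D F * G + F * fps_D G"
  by (simp add: fps_eq_iff fps_mult_nth sum.distrib)

text \<open>The shift distance is a real number so that shifts can be inverted.\<close>

definition dp_shift :: "real \<Rightarrow> diffpoly fps \<Rightarrow> diffpoly fps" where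
  "dp_shift r F = Abs_fps (\<lambda>k. \<Sum>i\<le>k. dp_const (r ^ i / fact i) * (dp_D ^^ i) (fps_nth F (k - i)))"

lemma dp_shift_nth:
  "fps_nth (dp_shift r F) k = (\<Sum>i\<le>k. dp_const (r ^ i / fact i) * (dp_D ^^ i) (fps_nth F (k - i)))"
  by (simp add: dp_shift_def)

lemma dp_shift_nth_0 [simp]: "fps_nth (dp_shift r F) 0 = fps_nth F 0"
  by (simp add: dp_shift_nth)

lemma dp_shift_add: "dp_shift r (F + G) = dp_shift r F + dp_shift r G"
  by (simp add: fps_eq_iff dp_shift_nth dp_D_pow_add distrib_left sum.distrib)

lemma dp_shift_const_mult: "dp_shift r (fps_const (dp_const s) * F)
    = fps_const (dp_const s) * dp_shift r F"
  by (simp add: fps_eq_iff dp_shift_nth dp_D_pow_const_mult sum_distrib_left mult_ac)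

lemma dp_shift_diff: "dp_shift r (F - G) = dp_shift r F - dp_shift r G"
  using dp_shift_add[of r "F - G" G] by simp

lemma dp_shift_one [simp]: "dp_shift r 1 = 1"
proof (rule fps_ext)
  fix k
  have "(dp_D ^^ i) (fps_nth 1 (k - i)) = 0" if "i \<le> k" "k \<noteq> 0" for i
    using that by (cases "k - i = 0") (simp_all add: dp_D_pow_one)
  then show "fps_nth (dp_shift r 1) k = fps_nth 1 k"
    by (cases "k = 0") (simp_all add: dp_shift_nth)
qed

lemma dp_shift_zero [simp]: "dp_shift 0 F = F"
proof -
  have "fps_nth (dp_shift 0 F) k = fps_nth F k" for k
  proof -
    have "fps_nth (dp_shift 0 F) k =
        (\<Sum>i\<in>{0}. dp_const (0 ^ i / fact i) * (dp_D ^^ i) (fps_nth F (k - i)))"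
      unfolding dp_shift_nth by (intro sum.mono_neutral_right) auto
    then show ?thesis by simp
  qed
  then show ?thesis by (simp add: fps_eq_iff)
qed

lemma fps_D_dp_shift: "fps_D (dp_shift r F) = dp_shift r (fps_D F)"
  by (simp add: fps_eq_iff dp_shift_nth funpow_swap1)

text \<open>At order \<open>n\<close> the shift only adds derivatives of coefficients of lower
  order, so it leaves the leading difference of two series unchanged.\<close>

lemma dp_shift_low_cong:
  assumes "\<And>k. k < n \<Longrightarrow> fps_nth F k = fps_nth G k"
  shows "k < n \<Longrightarrow> fps_nth (dp_shift r F) k = fps_nth (dp_shift r G) k"
    and "fps_nth (dp_shift r F) n - fps_nth (dp_shift r G) n = fps_nth F n - fps_nth G n"
proof -
  show "fps_nth (dp_shift r F) k = fps_nth (dp_shift r G) k" if "k < n"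
    using that assms by (simp add: dp_shift_nth)
  have "(\<Sum>i<n. dp_const (r ^ Suc i / fact (Suc i)) * (dp_D ^^ Suc i) (fps_nth F (n - Suc i)))
      = (\<Sum>i<n. dp_const (r ^ Suc i / fact (Suc i)) * (dp_D ^^ Suc i) (fps_nth G (n - Suc i)))"
    using assms
    by (intro sum.cong refl arg_cong2[of _ _ _ _ "(*)"] arg_cong[of _ _ "dp_D ^^ _"]) simp
  then show "fps_nth (dp_shift r F) n - fps_nth (dp_shift r G) n = fps_nth F n - fps_nth G n"
    unfolding dp_shift_nth sum.atMost_shift by simp
qed

text \<open>\<open>dp_shift r\<close> is \<open>exp (r \<epsilon> D)\<close>, so it intertwines \<open>d/d\<epsilon>\<close> with the derivation
  \<open>d/d\<epsilon> + r D\<close>. Comparing \<open>\<epsilon>\<close>-derivatives then gives multiplicativity and the group law by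
  induction on the order.\<close>
lemma fps_deriv_dp_shift:
  "fps_deriv (dp_shift r F) = dp_shift r (fps_deriv F + fps_const (dp_const r) * fps_D F)"
proof (rule fps_ext)
  fix k
  define T where "T i = dp_const (r ^ i / fact i) * (dp_D ^^ i) (fps_nth F (Suc k - i))" for i
  have T_Suc: "of_nat (Suc i) * T (Suc i)
      = dp_const (r ^ i / fact i) * (dp_const r * (dp_D ^^ Suc i) (fps_nth F (k - i)))" for i
  proof -
    have "of_nat (Suc i) * dp_const (r ^ Suc i / fact (Suc i))
        = dp_const (r ^ i / fact i) * dp_const r"
    proof -
      have "real (Suc i) * (r ^ Suc i / fact (Suc i)) = r ^ i / fact i * r"
        by (simp add: divide_simps del: of_nat_Suc)
      then show ?thesis by (metis dp_const_of_nat dp_const_simps(6))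
    qed
    then show ?thesis by (simp only: T_def diff_Suc_Suc mult.assoc[symmetric])
  qed
  \<comment> \<open>The factor \<open>Suc k\<close> is split as \<open>(Suc k - i) + i\<close>. The
    first part differentiates the coefficients of \<open>F\<close> with respect to
    \<open>\<epsilon>\<close>, the second lowers the exponential series by one term and produces
    \<open>r D\<close>.\<close>
  have "of_nat (Suc k) * (\<Sum>i\<le>Suc k. T i)
      = (\<Sum>i\<le>Suc k. of_nat (Suc k - i) * T i + of_nat i * T i)"
    unfolding sum_distrib_left
  proof (intro sum.cong refl)
    fix i assume "i \<in> {..Suc k}"
    then have "Suc k = (Suc k - i) + i" by simp
    then have "of_nat (Suc k) = (of_nat (Suc k - i) + of_nat i :: diffpoly)" by (metis of_nat_add)
    then show "of_nat (Suc k) * T i = of_nat (Suc k - i) * T i + of_nat i * T i"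
      by (simp only: distrib_right)
  qed
  also have "\<dots> = (\<Sum>i\<le>Suc k. of_nat (Suc k - i) * T i) + (\<Sum>i\<le>Suc k. of_nat i * T i)"
    by (rule sum.distrib)
  also have "(\<Sum>i\<le>Suc k. of_nat (Suc k - i) * T i) = (\<Sum>i\<le>k. of_nat (Suc k - i) * T i)"
    by simp
  also have "(\<Sum>i\<le>Suc k. of_nat i * T i) = (\<Sum>i\<le>k. of_nat (Suc i) * T (Suc i))"
    by (subst sum.atMost_Suc_shift) simp
  also have "(\<Sum>i\<le>k. of_nat (Suc k - i) * T i) + (\<Sum>i\<le>k. of_nat (Suc i) * T (Suc i))
      = (\<Sum>i\<le>k. dp_const (r ^ i / fact i) *
          (dp_D ^^ i) (of_nat (Suc k - i) * fps_nth F (Suc k - i)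
              + dp_const r * dp_D (fps_nth F (k - i))))"
    unfolding T_Suc sum.distrib[symmetric]
    by (intro sum.cong refl)
       (simp add: T_def dp_D_pow_add dp_D_pow_const_mult dp_D_pow_of_nat_mult funpow_swap1
         distrib_left mult.left_commute del: of_nat_Suc of_nat_diff)
  also have "\<dots> = fps_nth (dp_shift r (fps_deriv F + fps_const (dp_const r) * fps_D F)) k"
    unfolding dp_shift_nth by (intro sum.cong refl) (simp add: Suc_diff_le del: of_nat_Suc)
  finally show "fps_nth (fps_deriv (dp_shift r F)) k = \<dots>"
    by (simp add: T_def dp_shift_nth del: of_nat_Suc)
qed

text \<open>The factor \<open>Suc k\<close> brought in by \<open>fps_deriv\<close> can be cancelled
  over the differential polynomials; this drives the inductions on the order.\<close>

lemma fps_nth_Suc_eqI: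
  fixes F G :: "diffpoly fps"
  assumes "fps_nth (fps_deriv F) k = fps_nth (fps_deriv G) k"
  shows "fps_nth F (Suc k) = fps_nth G (Suc k)"
  using assms by (simp del: of_nat_Suc)

lemma dp_shift_mult: "dp_shift r (F * G) = dp_shift r F * dp_shift r G"
proof -
  let ?d = "\<lambda>F. fps_deriv F + fps_const (dp_const r) * fps_D F"
  have d: "?d (F * G) = ?d F * G + F * ?d G" for F G
    by (simp add: fps_D_mult algebra_simps)
  have "fps_nth (dp_shift r (F * G)) k = fps_nth (dp_shift r F * dp_shift r G) k" for k
  \<comment> \<open>Both series are generalised since the induction hypothesis is needed for the
    pairs \<open>?d F\<close>, \<open>G\<close> and \<open>F\<close>, \<open>?d G\<close>.\<close>
  proof (induction k arbitrary: F G)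
    case (Suc k)
    show ?case
    proof (rule fps_nth_Suc_eqI)
      have "fps_deriv (dp_shift r (F * G)) = dp_shift r (?d F * G) + dp_shift r (F * ?d G)"
        by (simp only: fps_deriv_dp_shift d dp_shift_add[of r "_ * _"])
      then show "fps_nth (fps_deriv (dp_shift r (F * G))) k
          = fps_nth (fps_deriv (dp_shift r F * dp_shift r G)) k"
        by (simp only: fps_deriv_mult fps_deriv_dp_shift fps_add_nth Suc.IH add.commute)
    qed
  qed simp
  then show ?thesis by (simp add: fps_eq_iff)
qed

lemma dp_shift_dp_shift: "dp_shift r (dp_shift s F) = dp_shift (r + s) F"
proof -
  have "fps_nth (dp_shift r (dp_shift s F)) k = fps_nth (dp_shift (r + s) F) k" for k
  proof (induction k arbitrary: F)
    case (Suc k)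
    show ?case
    proof (rule fps_nth_Suc_eqI)
      have "fps_deriv (dp_shift r (dp_shift s F))
          = dp_shift r (dp_shift s (fps_deriv F + fps_const (dp_const (r + s)) * fps_D F))"
        by (simp only: fps_deriv_dp_shift fps_D_dp_shift dp_shift_add dp_shift_const_mult dp_const_simps
            fps_const_add[symmetric] distrib_right add_ac)
      then show "fps_nth (fps_deriv (dp_shift r (dp_shift s F))) k
          = fps_nth (fps_deriv (dp_shift (r + s) F)) k"
        by (simp only: fps_deriv_dp_shift Suc.IH)
    qed
  qed simp
  then show ?thesis by (simp add: fps_eq_iff)
qed

section \<open>Series evaluated on the jets of a smooth field\<close>

definition dp_fps_eval :: "diffpoly fps \<Rightarrow> (nat \<Rightarrow> real) \<Rightarrow> real fps" where
  "dp_fps_eval F v = Abs_fps (\<lambda>k. dp_eval (fps_nth F k) v)"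

lemma dp_fps_eval_nth [simp]: "fps_nth (dp_fps_eval F v) k = dp_eval (fps_nth F k) v"
  by (simp add: dp_fps_eval_def)

lemma dp_fps_eval_simps [simp]:
  "dp_fps_eval 1 v = 1"
  "dp_fps_eval (F + G) v = dp_fps_eval F v + dp_fps_eval G v"
  "dp_fps_eval (F - G) v = dp_fps_eval F v - dp_fps_eval G v"
  "dp_fps_eval (F * G) v = dp_fps_eval F v * dp_fps_eval G v"
  "dp_fps_eval (fps_const P) v = fps_const (dp_eval P v)"
  "dp_fps_eval fps_X v = fps_X"
  by (simp_all add: fps_eq_iff fps_mult_nth fps_X_def)

lemma dp_fps_eval_power [simp]: "dp_fps_eval (F ^ n) v = dp_fps_eval F v ^ n"
  by (induction n) simp_all

definition jet :: "(real \<Rightarrow> real \<Rightarrow> real) \<Rightarrow> real \<Rightarrow> real \<Rightarrow> nat \<Rightarrow> real" where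
  "jet U x \<tau> = (\<lambda>j. (dx ^^ j) U x \<tau>)"

lemma dp_at_jet: "dp_at P U = (\<lambda>x \<tau>. dp_eval P (jet U x \<tau>))"
  by (simp add: fun_eq_iff dp_at_def jet_def)

text \<open>On the jets of a smooth field \<open>dx\<close> acts as \<open>dp_D\<close>, coefficient
  by coefficient. Lattice identities thereby reduce to identities between series over differential
  polynomials.\<close>

lemma shift_dp_fps_eval:
  assumes "smooth U"
  shows "shift j (\<lambda>x \<tau>. dp_fps_eval F (jet U x \<tau>)) x \<tau>
      = dp_fps_eval (dp_shift (real j) F) (jet U x \<tau>)"
proof -
  have "(fps_dx ^^ i) (\<lambda>x \<tau>. dp_fps_eval F (jet U x \<tau>))
      = (\<lambda>x \<tau>. dp_fps_eval ((fps_D ^^ i) F) (jet U x \<tau>))" for i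
  proof (induction i)
    case (Suc i)
    then show ?case
      using dx_dp_at[OF assms] by (simp add: fps_dx_def fun_eq_iff fps_eq_iff dp_at_jet)
  qed simp
  then show ?thesis
    by (simp add: shift_def fps_eq_iff dp_shift_nth fps_D_pow_nth)
qed

text \<open>Total derivatives vanish at the zero jet, so only the term \<open>i = 0\<close> of the
  exponential contributes.\<close>

lemma dp_fps_eval_dp_shift_at_zero: "dp_fps_eval (dp_shift r F) (\<lambda>j. 0) = dp_fps_eval F (\<lambda>j. 0)"
proof -
  have *: "dp_eval ((dp_D ^^ i) P) (\<lambda>j. 0) = (if i = 0 then dp_eval P (\<lambda>j. 0) else 0)" for i P
    by (cases i) (simp_all add: dp_eval_at_zero lookup_dp_D_zero)
  show ?thesis
    by (auto simp: fps_eq_iff dp_shift_nth * if_distrib cong: if_cong)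
qed

subsection \<open>Solving the constraint\<close>

lemma fps_mult_nth_low:
  fixes E B :: "'a::comm_ring_1 fps"
  assumes "\<And>k. k < n \<Longrightarrow> fps_nth E k = 0"
  shows "k < n \<Longrightarrow> fps_nth (E * B) k = 0" and "fps_nth (E * B) n = fps_nth E n * fps_nth B 0"
proof -
  show "fps_nth (E * B) k = 0" if "k < n"
    using that assms by (auto simp: fps_mult_nth intro!: sum.neutral)
  have "fps_nth (E * B) n = (\<Sum>i\<in>{n}. fps_nth E i * fps_nth B (n - i))"
    unfolding fps_mult_nth using assms by (intro sum.mono_neutral_right) auto
  then show "fps_nth (E * B) n = fps_nth E n * fps_nth B 0" by simp
qed

definition shift_prod :: "nat \<Rightarrow> diffpoly fps \<Rightarrow> diffpoly fps" where
  "shift_prod n p = (\<Prod>i<n. dp_shift (real i) p)"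

lemma shift_prod_0 [simp]: "shift_prod 0 p = 1"
  and shift_prod_Suc: "shift_prod (Suc n) p = shift_prod n p * dp_shift (real n) p"
  by (simp_all add: shift_prod_def)

lemma shift_prod_one [simp]: "shift_prod n 1 = 1"
  by (simp add: shift_prod_def)

text \<open>A cocycle law. Splitting \<open>m + l\<close> factors after the first \<open>m\<close>
  or after the first \<open>l\<close> gives the two sides of the constraint.\<close>

lemma shift_prod_add: "shift_prod (m + n) p = shift_prod m p * dp_shift (real m) (shift_prod n p)"
  by (induction n) (simp_all add: shift_prod_Suc dp_shift_mult dp_shift_dp_shift mult_ac)

lemma shift_prod_nth_0: "fps_nth p 0 = 1 \<Longrightarrow> fps_nth (shift_prod n p) 0 = 1"
  by (induction n) (simp_all add: shift_prod_Suc)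

text \<open>The linearisation of the product: a change of \<open>p\<close> at order \<open>n\<close>
  changes each of the \<open>j\<close> factors by the same amount there, and the remaining factors
  have constant term 1.\<close>

lemma shift_prod_low_cong:
  assumes "\<And>k. k < n \<Longrightarrow> fps_nth p k = fps_nth q k" "fps_nth p 0 = 1" "fps_nth q 0 = 1"
  shows "(\<forall>k<n. fps_nth (shift_prod j p) k = fps_nth (shift_prod j q) k) \<and>
    fps_nth (shift_prod j p) n - fps_nth (shift_prod j q) n
        = of_nat j * (fps_nth p n - fps_nth q n)"
proof (induction j)
  case (Suc j)
  let ?E = "shift_prod j p - shift_prod j q" and ?E' = "dp_shift (real j) p - dp_shift (real j) q"
  have E: "fps_nth ?E k = 0" "fps_nth ?E' k = 0" if "k < n" for k
    using that Suc.IH dp_shift_low_cong(1)[OF assms(1)] by auto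
  have E': "fps_nth ?E' n = fps_nth p n - fps_nth q n"
    using dp_shift_low_cong(2)[OF assms(1)] by simp
  have "shift_prod (Suc j) p - shift_prod (Suc j) q
      = ?E * dp_shift (real j) p + ?E' * shift_prod j q"
    by (simp add: shift_prod_Suc algebra_simps)
  then have *: "fps_nth (shift_prod (Suc j) p) k - fps_nth (shift_prod (Suc j) q) k
      = fps_nth (?E * dp_shift (real j) p) k + fps_nth (?E' * shift_prod j q) k" for k
    by (metis fps_add_nth fps_sub_nth)
  have "fps_nth (shift_prod (Suc j) p) k - fps_nth (shift_prod (Suc j) q) k = 0" if "k < n" for k
    using *[of k] that fps_mult_nth_low(1)[of n ?E, OF E(1)] fps_mult_nth_low(1)[of n ?E', OF E(2)]
    by simp
  moreover have "fps_nth (shift_prod (Suc j) p) n - fps_nth (shift_prod (Suc j) q) n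
      = of_nat (Suc j) * (fps_nth p n - fps_nth q n)"
  proof -
    have "fps_nth (?E * dp_shift (real j) p) n = of_nat j * (fps_nth p n - fps_nth q n)"
      using fps_mult_nth_low(2)[of n ?E, OF E(1)] Suc.IH assms(2) by simp
    moreover have "fps_nth (?E' * shift_prod j q) n = fps_nth p n - fps_nth q n"
      using fps_mult_nth_low(2)[of n ?E', OF E(2)] E' shift_prod_nth_0[OF assms(3)] by simp
    ultimately show ?thesis by (simp add: * distrib_right)
  qed
  ultimately show ?case by simp
qed simp

text \<open>Successive approximation: by the linearisation, a new coefficient of \<open>p\<close>
  enters the product at its own order with the factor \<open>L\<close>, so division by
  \<open>L\<close> determines it.\<close>

lemma shift_prod_root:
  assumes "L > 0" "fps_nth V 0 = 1"
  obtains p where "fps_nth p 0 = 1" "shift_prod L p = V"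
proof -
  have "\<exists>f. \<forall>n. (fps_nth (f n) 0 = 1 \<and> (\<forall>k\<le>n. fps_nth (shift_prod L (f n)) k = fps_nth V k)) \<and>
      (\<forall>k\<le>n. fps_nth (f (Suc n)) k = fps_nth (f n) k)"
  proof (rule dependent_nat_choice)
    show "\<exists>p. fps_nth p 0 = 1 \<and> (\<forall>k\<le>0. fps_nth (shift_prod L p) k = fps_nth V k)"
      using assms by (intro exI[of _ 1]) simp
  next
    fix p n
    assume p: "fps_nth p 0 = 1 \<and> (\<forall>k\<le>n. fps_nth (shift_prod L p) k = fps_nth V k)"
    \<comment> \<open>The error at order \<open>Suc n\<close>, divided by the factor
      \<open>L\<close> with which a correction of \<open>p\<close> at that order acts.\<close>
    define r where "r = dp_const (1 / real L)
        * (fps_nth V (Suc n) - fps_nth (shift_prod L p) (Suc n))"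
    define q where "q = p + fps_const r * fps_X ^ Suc n"
    have q: "fps_nth q k = fps_nth p k" if "k \<le> n" for k
      using that by (simp add: q_def fps_X_power_nth del: power_Suc)
    have "fps_nth q (Suc n) = fps_nth p (Suc n) + r"
      by (simp add: q_def fps_X_power_nth del: power_Suc)
    moreover have "of_nat L * r = fps_nth V (Suc n) - fps_nth (shift_prod L p) (Suc n)"
    proof -
      have "of_nat L * dp_const (1 / real L) = 1"
        using assms(1) by (simp flip: dp_const_of_nat dp_const_simps(6))
      then show ?thesis by (simp add: r_def mult.assoc[symmetric])
    qed
    ultimately have "fps_nth (shift_prod L q) k = fps_nth V k" if "k \<le> Suc n" for k
      using that shift_prod_low_cong[of "Suc n" q p L] q p by (auto simp: le_Suc_eq less_Suc_eq_le)
    with p q show "\<exists>q. (fps_nth q 0 = 1 \<and> (\<forall>k\<le>Suc n. fps_nth (shift_prod L q) k = fps_nth V k)) \<and>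
        (\<forall>k\<le>n. fps_nth q k = fps_nth p k)"
      by (intro exI[of _ q]) auto
  qed
  then obtain f where f: "\<And>n. fps_nth (f n) 0 = 1"
      "\<And>n k. k \<le> n \<Longrightarrow> fps_nth (shift_prod L (f n)) k = fps_nth V k"
      "\<And>n k. k \<le> n \<Longrightarrow> fps_nth (f (Suc n)) k = fps_nth (f n) k"
    by blast
  \<comment> \<open>The diagonal limit: coefficient \<open>k\<close> no longer changes after the
    approximation \<open>f k\<close>.\<close>
  define p where "p = Abs_fps (\<lambda>k. fps_nth (f k) k)"
  have p: "fps_nth p k = fps_nth (f n) k" if "k \<le> n" for k n
    using that
  proof (induction n rule: dec_induct)
    case (step n)
    then show ?case using f(3)[of k n] by simp
  qed (simp add: p_def)
  have p0: "fps_nth p 0 = 1" by (simp add: p_def f(1))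
  have "fps_nth (shift_prod L p) n = fps_nth V n" for n
    using shift_prod_low_cong[of "Suc n" p "f n" L] p f(1,2) p0 by (auto simp: less_Suc_eq_le)
  then show thesis using that[OF p0] by (simp add: fps_eq_iff)
qed

text \<open>Factor \<open>P ^ n - 1\<close> by the geometric sum; the cofactor of
  \<open>P - 1\<close> has constant term \<open>n\<close>, hence is not zero.\<close>

lemma fps_power_eq_1:
  fixes P :: "real fps"
  assumes "P ^ n = 1" "fps_nth P 0 = 1" "n > 0"
  shows "P = 1"
proof -
  have "fps_nth (\<Sum>i<n. P ^ i) 0 = real n"
    by (simp add: fps_sum_nth fps_power_zeroth assms(2))
  then have "(\<Sum>i<n. P ^ i) \<noteq> 0" using assms(3) by auto
  moreover have "(P - 1) * (\<Sum>i<n. P ^ i) = 0"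
    using power_diff_1_eq[of P n] assms(1) by simp
  ultimately show ?thesis by simp
qed

section \<open>Existence and uniqueness of the solution\<close>

definition dp_u :: "real \<Rightarrow> diffpoly fps" where
  "dp_u b = 1 + fps_const (dp_const b * dp_var 0) * fps_X ^ 2"

lemma dp_u_nth: "fps_nth (dp_u b) k
    = (if k = 0 then 1 else if k = 2 then dp_const b * dp_var 0 else 0)"
  by (simp add: dp_u_def fps_X_power_nth)

lemma dp_fps_eval_dp_u_at_zero [simp]: "dp_fps_eval (dp_u b) (\<lambda>j. 0) = 1"
  by (simp add: fps_eq_iff dp_u_nth)

definition dp_constraint :: "nat \<Rightarrow> nat \<Rightarrow> real \<Rightarrow> diffpoly fps \<Rightarrow> bool" where
  "dp_constraint m l b F \<longleftrightarrow>
     dp_shift (real m) (dp_u b) * dp_shift (real m) F = dp_u b * dp_shift (real (m + l)) F"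

text \<open>Both sides of the constraint become \<open>p p\<^sub>1 \<dots> p\<^bsub>m+l-1\<^esub>\<close>.\<close>
lemma dp_constraint_solution:
  assumes "l > 0"
  obtains F where "dp_constraint m l b F" "fps_nth F 0 = 1" "fps_nth F 1 = 0"
    "\<And>k. k > 0 \<Longrightarrow> Poly_Mapping.lookup (fps_nth F k) 0 = 0"
proof -
  obtain p where p: "fps_nth p 0 = 1" "shift_prod l p = dp_u b"
    using shift_prod_root[OF assms, of "dp_u b"] by (auto simp: dp_u_nth)
  \<comment> \<open>Shifting back by \<open>m\<close> makes the shift of \<open>F\<close> by
    \<open>m\<close> equal to the product of \<open>m\<close> consecutive shifts of
    \<open>p\<close>.\<close>
  define F where "F = dp_shift (- real m) (shift_prod m p)"
  have F: "dp_shift (real m + r) F = dp_shift r (shift_prod m p)" for r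
    by (simp add: F_def dp_shift_dp_shift)
  have "dp_shift (real m) (dp_u b) * dp_shift (real m) F = shift_prod (m + l) p"
    using F[of 0] p(2) by (simp add: shift_prod_add mult.commute)
  also have "\<dots> = dp_u b * dp_shift (real (m + l)) F"
    using F[of "real l"] p(2) by (simp add: shift_prod_add[of l m] add.commute[of m l] add.commute[of "real m"])
  finally have 1: "dp_constraint m l b F" by (simp add: dp_constraint_def)
  have 2: "fps_nth F 0 = 1" by (simp add: F_def shift_prod_nth_0 p)
  \<comment> \<open>Comparison with the series 1: the coefficient of order 1 is additive over the
    factors. It vanishes in \<open>dp_u b\<close>, hence in \<open>p\<close>, hence in
    \<open>F\<close>.\<close>
  have low: "fps_nth (shift_prod j p) 1 = of_nat j * fps_nth p 1" for j
    using shift_prod_low_cong[of 1 p 1 j] p(1) by simp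
  have "of_nat l * fps_nth p 1 = 0" using low[of l] p(2) by (simp add: dp_u_nth)
  then have "fps_nth p 1 = 0" using assms by simp
  then have 3: "fps_nth F 1 = 0"
    using dp_shift_low_cong(2)[of 1 "shift_prod m p" 1 "- real m"] low[of m]
      shift_prod_nth_0[OF p(1)]
    by (simp add: F_def)
  \<comment> \<open>At the zero jet all shifts act trivially, so the product of shifts becomes the
    plain power \<open>?P ^ l\<close>, equal to 1. Thus \<open>?P\<close> is 1, and \<open>F\<close>
    has no constant terms beyond order 0.\<close>
  let ?P = "dp_fps_eval p (\<lambda>j. 0)"
  have P: "dp_fps_eval (shift_prod j p) (\<lambda>j. 0) = ?P ^ j" for j
    by (induction j) (simp_all add: shift_prod_Suc dp_fps_eval_dp_shift_at_zero mult.commute)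
  have "?P = 1"
    by (rule fps_power_eq_1[OF _ _ assms]) (use P[of l] p in simp_all)
  then have "dp_fps_eval F (\<lambda>j. 0) = 1"
    by (simp add: F_def dp_fps_eval_dp_shift_at_zero P)
  then have "Poly_Mapping.lookup (fps_nth F k) 0 = 0" if "k > 0" for k
    using that by (metis dp_eval_at_zero dp_fps_eval_nth fps_nonzero_nth fps_one_nth less_numeral_extra(3))
  with 1 2 3 show thesis by (intro that)
qed

lemma dp_constraint_diff: "dp_constraint m l b F \<Longrightarrow> dp_constraint m l b G
    \<Longrightarrow> dp_constraint m l b (F - G)"
  by (simp add: dp_constraint_def dp_shift_diff right_diff_distrib)

text \<open>The constraint is linear in \<open>F\<close>, so \<open>E\<close> solves it as well. If
  \<open>E\<close> vanishes below order \<open>n\<close>, order \<open>n + 1\<close> equates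
  \<open>m\<close> and \<open>m + l\<close> times the derivative of its coefficient
  \<open>n\<close>; the derivative is then zero, and so is the coefficient because its constant term
  vanishes.\<close>

lemma dp_constraint_unique:
  assumes "l > 0" "dp_constraint m l b F" "dp_constraint m l b G"
    and "\<And>k. Poly_Mapping.lookup (fps_nth F k) 0 = Poly_Mapping.lookup (fps_nth G k) 0"
  shows "F = G"
proof -
  define E where "E = F - G"
  have E: "dp_constraint m l b E" using assms dp_constraint_diff by (simp add: E_def)
  have "fps_nth E n = 0" for n
  proof (induction n rule: less_induct)
    case (less n)
    have S: "fps_nth (dp_shift r E) k = (if k = n then fps_nth E n
        else if k = Suc n then fps_nth E (Suc n) + dp_const r * dp_D (fps_nth E n) else 0)"
      if "k \<le> Suc n" for k r
    proof (cases "k \<le> n")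
      case True
      then show ?thesis
        \<comment> \<open>\<open>E\<close> is compared with the zero series; the instance of
          \<open>dp_shift_diff\<close> shows that the shift of zero is zero.\<close>
        using dp_shift_low_cong(1)[of n E 0 k r] dp_shift_low_cong(2)[of n E 0 r] less
          dp_shift_diff[of r E E] by auto
    next
      case False
      then have k: "k = Suc n" using that by simp
      have "fps_nth (dp_shift r E) (Suc n)
          = (\<Sum>i\<in>{0, 1}. dp_const (r ^ i / fact i) * (dp_D ^^ i) (fps_nth E (Suc n - i)))"
        unfolding dp_shift_nth
      proof (intro sum.mono_neutral_right ballI)
        fix i assume "i \<in> {..Suc n} - {0, 1}"
        then have "fps_nth E (Suc n - i) = 0" by (intro less) auto
        then show "dp_const (r ^ i / fact i) * (dp_D ^^ i) (fps_nth E (Suc n - i)) = 0" by simp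
      qed auto
      then show ?thesis using k by simp
    qed
    \<comment> \<open>The shifted \<open>E\<close> vanishes below order \<open>n\<close>, so only
      the orders 0 and 1 of \<open>W\<close> can contribute.\<close>
    have *: "fps_nth (W * dp_shift r E) (Suc n)
        = fps_nth E (Suc n) + dp_const r * dp_D (fps_nth E n)"
      if "fps_nth W 0 = 1" "fps_nth W 1 = 0" for W r
    proof -
      have "fps_nth (W * dp_shift r E) (Suc n)
          = (\<Sum>i\<in>{0, 1}. fps_nth W i * fps_nth (dp_shift r E) (Suc n - i))"
        unfolding fps_mult_nth
        by (intro sum.mono_neutral_right) (auto simp: S)
      then show ?thesis using that by (simp add: S)
    qed
    have "fps_nth (dp_shift (real m) (dp_u b)) 1 = 0"
      by (simp add: dp_shift_nth dp_u_nth)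
    then have "dp_const (real m) * dp_D (fps_nth E n)
        = dp_const (real (m + l)) * dp_D (fps_nth E n)"
      using arg_cong[OF E[unfolded dp_constraint_def], of "\<lambda>F. fps_nth F (Suc n)"]
      by (simp add: * dp_u_nth del: of_nat_add)
    then have "dp_D (fps_nth E n) = 0"
      using assms(1) by (simp add: distrib_right)
    then show ?case
      by (rule dp_D_kernel) (simp add: E_def lookup_minus assms(4))
  qed
  then have "E = 0" by (simp add: fps_eq_iff)
  then show ?thesis by (simp add: E_def)
qed

section \<open>From fields to series of differential polynomials\<close>

definition dp_f :: "(nat \<Rightarrow> diffpoly) \<Rightarrow> diffpoly fps" where
  "dp_f Y = 1 + Abs_fps (\<lambda>s. if s \<ge> 2 then Y s else 0)"

lemma dp_f_nth: "fps_nth (dp_f Y) k = (if k = 0 then 1 else if k \<ge> 2 then Y k else 0)"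
  by (simp add: dp_f_def)

lemma lattice_f_eval: "lattice_f Y U = (\<lambda>x \<tau>. dp_fps_eval (dp_f Y) (jet U x \<tau>))"
  by (auto simp: lattice_f_def fun_eq_iff fps_eq_iff dp_f_nth dp_at_jet)

lemma lattice_u_eval: "lattice_u a b U
    = (\<lambda>x \<tau>. dp_fps_eval (fps_const (dp_const a) * dp_u b) (jet U x \<tau>))"
  by (auto simp: lattice_u_def fun_eq_iff fps_eq_iff dp_u_nth jet_def fps_X_power_nth)

lemma lattice_u_1_eval: "lattice_u 1 b U = (\<lambda>x \<tau>. dp_fps_eval (dp_u b) (jet U x \<tau>))"
  by (simp add: lattice_u_eval)

lemma dp_fps_eval_inject:
  assumes "\<And>U x \<tau>. smooth U \<Longrightarrow> dp_fps_eval F (jet U x \<tau>) = dp_fps_eval G (jet U x \<tau>)"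
  shows "F = G"
proof (rule fps_ext, rule dp_at_inject)
  fix k U x \<tau> assume "smooth U"
  then show "dp_at (fps_nth F k) U x \<tau> = dp_at (fps_nth G k) U x \<tau>"
    using arg_cong[OF assms, of U "\<lambda>F. fps_nth F k"] by (simp add: dp_at_jet)
qed

text \<open>Since smooth fields separate differential polynomials, the requirement for all
  \<open>U\<close>, \<open>x\<close> and \<open>\<tau>\<close> collapses to a single identity of
  series, to which the existence and uniqueness results apply.\<close>

lemma constraint_ansatz_iff:
  "constraint_ansatz m l b Y \<longleftrightarrow> Y 0 = 0 \<and> Y 1 = 0 \<and>
     (\<forall>s\<ge>2. Poly_Mapping.lookup (Y s) 0 = 0) \<and> dp_constraint m l b (dp_f Y)"
proof -
  have "(\<forall>U. smooth U \<longrightarrow> (\<forall>x \<tau>.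
        shift m (lattice_u 1 b U) x \<tau> * shift m (lattice_f Y U) x \<tau>
        = lattice_u 1 b U x \<tau> * shift (m + l) (lattice_f Y U) x \<tau>)) \<longleftrightarrow>
    (\<forall>U. smooth U \<longrightarrow> (\<forall>x \<tau>.
        dp_fps_eval (dp_shift (real m) (dp_u b) * dp_shift (real m) (dp_f Y)) (jet U x \<tau>)
        = dp_fps_eval (dp_u b * dp_shift (real (m + l)) (dp_f Y)) (jet U x \<tau>)))"
    unfolding lattice_f_eval lattice_u_1_eval dp_fps_eval_simps
    by (simp only: shift_dp_fps_eval cong: imp_cong)
  also have "\<dots> \<longleftrightarrow> dp_constraint m l b (dp_f Y)"
    unfolding dp_constraint_def by (auto intro: dp_fps_eval_inject simp del: dp_fps_eval_simps)
  finally show ?thesis by (simp add: constraint_ansatz_def)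
qed

lemma constraint_ansatz_ex1:
  assumes "l > 0" shows "\<exists>!Y. constraint_ansatz m l b Y"
proof (rule ex_ex1I)
  obtain F where F: "dp_constraint m l b F" "fps_nth F 0 = 1" "fps_nth F 1 = 0"
    "\<And>k. k > 0 \<Longrightarrow> Poly_Mapping.lookup (fps_nth F k) 0 = 0"
    using dp_constraint_solution[OF assms] by blast
  have "dp_f (\<lambda>k. if k \<ge> 2 then fps_nth F k else 0) = F"
    using F(2,3) by (auto simp: fps_eq_iff dp_f_nth)
        (metis One_nat_def Suc_1 Suc_leI le_neq_implies_less neq0_conv)
  then show "\<exists>Y. constraint_ansatz m l b Y"
    using F by (intro exI[of _ "\<lambda>k. if k \<ge> 2 then fps_nth F k else 0"])
        (simp add: constraint_ansatz_iff)
next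
  fix Y Z assume YZ: "constraint_ansatz m l b Y" "constraint_ansatz m l b Z"
  then have "dp_f Y = dp_f Z"
    using assms by (intro dp_constraint_unique[of l m b])
        (auto simp: constraint_ansatz_iff dp_f_nth)
  show "Y = Z"
  proof
    fix k
    show "Y k = Z k"
    proof (cases "k \<ge> 2")
      case True
      then show ?thesis using arg_cong[OF \<open>dp_f Y = dp_f Z\<close>, of "\<lambda>F. fps_nth F k"]
          by (simp add: dp_f_nth)
    next
      case False
      then have "k = 0 \<or> k = 1" by auto
      then show ?thesis using YZ by (auto simp: constraint_ansatz_iff)
    qed
  qed
qed

subsection \<open>Expansion up to order 7\<close>

lemma dp_shift_dp_u_nth:
  "fps_nth (dp_shift r (dp_u b)) k = (if k = 0 then 1 else if k = 1 then 0
     else dp_const (b * r ^ (k - 2) / fact (k - 2)) * dp_var (k - 2))"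
proof -
  have D: "(dp_D ^^ i) (dp_const b * dp_var 0) = dp_const b * dp_var i" for i
    by (induction i) simp_all
  show ?thesis
  proof (cases "k \<ge> 2")
    case True
    have "fps_nth (dp_shift r (dp_u b)) k
        = (\<Sum>i\<in>{k - 2}. dp_const (r ^ i / fact i) * (dp_D ^^ i) (fps_nth (dp_u b) (k - i)))"
      unfolding dp_shift_nth
    proof (intro sum.mono_neutral_right ballI)
      \<comment> \<open>Besides order 2 only the constant term 1 of \<open>dp_u b\<close> is
        nonzero; it is met at \<open>i = k\<close> and killed by the derivatives.\<close>
      fix i assume i: "i \<in> {..k} - {k - 2}"
      then have "k - i \<noteq> 2" using True by auto
      then show "dp_const (r ^ i / fact i) * (dp_D ^^ i) (fps_nth (dp_u b) (k - i)) = 0"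
        using True i by (auto simp: dp_u_nth dp_D_pow_one)
    qed auto
    then show ?thesis
      using True by (simp add: D dp_u_nth mult.assoc[symmetric] flip: dp_const_simps(6))
          (simp add: mult.commute)
  next
    case False
    then have "k = 0 \<or> k = 1" by auto
    then show ?thesis by (auto simp: dp_shift_nth dp_u_nth)
  qed
qed

lemma dp_shift_dp_u_nth_small:
  "fps_nth (dp_shift r (dp_u b)) 2 = dp_const b * dp_var 0"
  "fps_nth (dp_shift r (dp_u b)) 3 = dp_const (b * r) * dp_var 1"
  "fps_nth (dp_shift r (dp_u b)) 4 = dp_const (b * r ^ 2 / 2) * dp_var 2"
  "fps_nth (dp_shift r (dp_u b)) 5 = dp_const (b * r ^ 3 / 6) * dp_var 3"
  "fps_nth (dp_shift r (dp_u b)) 6 = dp_const (b * r ^ 4 / 24) * dp_var 4"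
  "fps_nth (dp_shift r (dp_u b)) 7 = dp_const (b * r ^ 5 / 120) * dp_var 5"
  by (simp_all add: dp_shift_dp_u_nth fact_numeral)

lemma dp_u_nth_small:
  "fps_nth (dp_u b) 2 = dp_const b * dp_var 0" "fps_nth (dp_u b) 3 = 0" "fps_nth (dp_u b) 4 = 0"
  "fps_nth (dp_u b) 5 = 0" "fps_nth (dp_u b) 6 = 0" "fps_nth (dp_u b) 7 = 0"
  by (simp_all add: dp_u_nth)

lemma dp_shift_nth_low:
  assumes "fps_nth F 0 = 1" "fps_nth F 1 = 0"
  shows "fps_nth (dp_shift r F) 1 = 0"
  "fps_nth (dp_shift r F) 2 = fps_nth F 2"
  "fps_nth (dp_shift r F) 3 = fps_nth F 3 + dp_const r * dp_D (fps_nth F 2)"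
  "fps_nth (dp_shift r F) 4 = fps_nth F 4 + dp_const r * dp_D (fps_nth F 3)
      + dp_const (r ^ 2 / 2) * dp_D (dp_D (fps_nth F 2))"
  "fps_nth (dp_shift r F) 5 = fps_nth F 5 + dp_const r * dp_D (fps_nth F 4)
      + dp_const (r ^ 2 / 2) * dp_D (dp_D (fps_nth F 3))
      + dp_const (r ^ 3 / 6) * dp_D (dp_D (dp_D (fps_nth F 2)))"
  "fps_nth (dp_shift r F) 6 = fps_nth F 6 + dp_const r * dp_D (fps_nth F 5)
      + dp_const (r ^ 2 / 2) * dp_D (dp_D (fps_nth F 4))
      + dp_const (r ^ 3 / 6) * dp_D (dp_D (dp_D (fps_nth F 3)))
      + dp_const (r ^ 4 / 24) * dp_D (dp_D (dp_D (dp_D (fps_nth F 2))))"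
  "fps_nth (dp_shift r F) 7 = fps_nth F 7 + dp_const r * dp_D (fps_nth F 6)
      + dp_const (r ^ 2 / 2) * dp_D (dp_D (fps_nth F 5))
      + dp_const (r ^ 3 / 6) * dp_D (dp_D (dp_D (fps_nth F 4)))
      + dp_const (r ^ 4 / 24) * dp_D (dp_D (dp_D (dp_D (fps_nth F 3))))
      + dp_const (r ^ 5 / 120) * dp_D (dp_D (dp_D (dp_D (dp_D (fps_nth F 2)))))"
  using assms by (simp_all add: dp_shift_nth eval_nat_numeral)

lemma fps_mult_nth_small:
  fixes A B :: "'a::comm_ring_1 fps"
  assumes "fps_nth A 0 = 1" "fps_nth A 1 = 0" "fps_nth B 0 = 1" "fps_nth B 1 = 0"
  shows "fps_nth (A * B) 0 = 1" "fps_nth (A * B) 1 = 0"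
  "fps_nth (A * B) 2 = fps_nth A 2 + fps_nth B 2"
  "fps_nth (A * B) 3 = fps_nth A 3 + fps_nth B 3"
  "fps_nth (A * B) 4 = fps_nth A 4 + fps_nth B 4 + fps_nth A 2 * fps_nth B 2"
  "fps_nth (A * B) 5 = fps_nth A 5 + fps_nth B 5 + fps_nth A 2 * fps_nth B 3
      + fps_nth A 3 * fps_nth B 2"
  "fps_nth (A * B) 6 = fps_nth A 6 + fps_nth B 6 + fps_nth A 2 * fps_nth B 4
      + fps_nth A 3 * fps_nth B 3 + fps_nth A 4 * fps_nth B 2"
  "fps_nth (A * B) 7 = fps_nth A 7 + fps_nth B 7 + fps_nth A 2 * fps_nth B 5
      + fps_nth A 3 * fps_nth B 4 + fps_nth A 4 * fps_nth B 3 + fps_nth A 5 * fps_nth B 2"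
  using assms by (simp_all add: fps_mult_nth eval_nat_numeral)

lemma dp_eqI: "(\<And>v. dp_eval P v = dp_eval Q v) \<Longrightarrow> P = Q"
  using dp_eval_inject[of "P - Q"] by simp

text \<open>Integration of a differential polynomial: the constant of integration is fixed by the
  constant term.\<close>

lemma dp_eq_by_kernel:
  assumes "\<And>v. dp_eval (dp_D P) v = dp_eval (dp_D Q) v"
    and "Poly_Mapping.lookup P 0 = Poly_Mapping.lookup Q 0"
  shows "P = Q"
proof -
  have "dp_D (P - Q) = 0" using assms(1) by (intro dp_eval_inject) simp
  then have "P - Q = 0" by (rule dp_D_kernel) (simp add: lookup_minus assms(2))
  then show ?thesis by simp
qed

section \<open>Coefficients of \<open>f\<close> from the orders 3 to 7 of the constraint\<close>

locale sawada_kotera_constraint =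
  fixes m l :: nat and b :: real and F :: "diffpoly fps"
  assumes lpos: "l > 0" and b: "b = real m * real l / 6"
    and F: "dp_constraint m l b F" "fps_nth F 0 = 1" "fps_nth F 1 = 0"
    and F_const: "\<And>k. k > 0 \<Longrightarrow> Poly_Mapping.lookup (fps_nth F k) 0 = 0"
begin

lemma dp_shift_F_nth_0_1: "fps_nth (dp_shift r F) 0 = 1" "fps_nth (dp_shift r F) 1 = 0"
  using F dp_shift_nth_low(1) by simp_all

lemma dp_shift_u_nth_0_1:
  "fps_nth (dp_shift r (dp_u b)) 0 = 1" "fps_nth (dp_shift r (dp_u b)) 1 = 0"
  "fps_nth (dp_u b) 0 = 1" "fps_nth (dp_u b) 1 = 0"
  by (simp_all add: dp_shift_dp_u_nth dp_u_nth)

lemma constraint_order: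
  "fps_nth (dp_shift (real m) (dp_u b) * dp_shift (real m) F) k
    = fps_nth (dp_u b * dp_shift (real m + real l) F) k"
  using F(1) by (simp add: dp_constraint_def)

text \<open>The coefficient \<open>k\<close> of \<open>F\<close> occurs on both sides of order
  \<open>k\<close> and cancels. What remains determines \<open>l\<close> times the derivative of
  coefficient \<open>k - 1\<close>, so orders 3 to 7 serve the coefficients 2 to 6.\<close>

lemmas constraint_orders = constraint_order[of 3] constraint_order[of 4] constraint_order[of 5]
  constraint_order[of 6] constraint_order[of 7]

lemmas constraint_orders_expanded = constraint_orders[unfolded
  fps_mult_nth_small[OF dp_shift_u_nth_0_1(1,2) dp_shift_F_nth_0_1]
  fps_mult_nth_small[OF dp_shift_u_nth_0_1(3,4) dp_shift_F_nth_0_1]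
  dp_shift_nth_low[OF F(2,3)] dp_shift_dp_u_nth_small dp_u_nth_small]

lemmas constraint_order_3 = constraint_orders_expanded(1)
  and constraint_order_4 = constraint_orders_expanded(2)
  and constraint_order_5 = constraint_orders_expanded(3)
  and constraint_order_6 = constraint_orders_expanded(4)
  and constraint_order_7 = constraint_orders_expanded(5)

lemma mult_l_cancel: "real l * x = real l * y \<Longrightarrow> x = y"
  using lpos by simp

lemma Suc_numerals: "Suc (Suc 0) = 2" "Suc 2 = 3" "Suc 3 = 4" "Suc 4 = 5" "Suc 5 = 6"
  by simp_all

text \<open>This is \<open>m b / l\<close> times \<open>U\<close> with \<open>b = m l / 6\<close>
  inserted. As for the next two coefficients, the constraint gives \<open>l\<close> times the
  derivative, \<open>l\<close> is cancelled, and the result is integrated with zero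
  constant.\<close>

lemma F_2: "fps_nth F 2 = dp_const (real m ^ 2 / 6) * dp_var 0"
  (is "_ = ?Q")
proof (rule dp_eq_by_kernel)
  fix v
  have "real l * dp_eval (dp_D (fps_nth F 2)) v
      = real l * (real m ^ 2 / 6 * v (Suc 0))"
      (is "_ = _ * ?E")
    using arg_cong[OF constraint_order_3, of "\<lambda>P. dp_eval P v",
        unfolded b, simplified, unfolded Suc_numerals]
    by (auto simp: field_simps eval_nat_numeral)
  then have "dp_eval (dp_D (fps_nth F 2)) v = ?E"
    by (rule mult_l_cancel)
  then show "dp_eval (dp_D (fps_nth F 2)) v = dp_eval (dp_D ?Q) v"
    by (simp add: Suc_numerals power2_eq_square field_simps)
qed (use F_const[of 2] in \<open>simp flip: dp_eval_at_zero\<close>)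

lemma F_3: "fps_nth F 3 = - dp_const (real m ^ 2 * (real m + real l) / 12) * dp_var 1"
  (is "_ = ?Q")
proof (rule dp_eq_by_kernel)
  fix v
  have "real l * dp_eval (dp_D (fps_nth F 3)) v
      = real l * (- (real m ^ 2 * (real m + real l) / 12) * v 2)"
      (is "_ = _ * ?E")
    using arg_cong[OF constraint_order_4, of "\<lambda>P. dp_eval P v",
        unfolded F_2 b, simplified, unfolded Suc_numerals]
    by (simp add: field_simps eval_nat_numeral)
  then have "dp_eval (dp_D (fps_nth F 3)) v = ?E"
    by (rule mult_l_cancel)
  then show "dp_eval (dp_D (fps_nth F 3)) v = dp_eval (dp_D ?Q) v"
    by (simp add: Suc_numerals power2_eq_square field_simps)
qed (use F_const[of 3] in \<open>simp flip: dp_eval_at_zero\<close>)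

lemma F_4: "fps_nth F 4 = dp_const (real m ^ 2 * (real m + real l) * (2 * real m + real l) / 72)
    * dp_var 2
    + dp_const (real m ^ 3 * (real m - real l) / 72) * dp_var 0 ^ 2"
  (is "_ = ?Q")
proof (rule dp_eq_by_kernel)
  fix v
  have "real l * dp_eval (dp_D (fps_nth F 4)) v
      = real l * (real m ^ 2 * (real m + real l) * (2 * real m + real l) / 72 * v 3
    + real m ^ 3 * (real m - real l) / 36 * v 0 * v (Suc 0))"
      (is "_ = _ * ?E")
    using arg_cong[OF constraint_order_5, of "\<lambda>P. dp_eval P v",
        unfolded F_2 F_3 b, simplified, unfolded Suc_numerals]
    by (simp add: field_simps eval_nat_numeral)
  then have "dp_eval (dp_D (fps_nth F 4)) v = ?E"
    by (rule mult_l_cancel)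
  then show "dp_eval (dp_D (fps_nth F 4)) v = dp_eval (dp_D ?Q) v"
    by (simp add: Suc_numerals power2_eq_square field_simps)
qed (use F_const[of 4] in \<open>simp flip: dp_eval_at_zero\<close>)

text \<open>Read off order 6 without integration. The two quadratic terms have equal coefficients
  and together form the derivative of \<open>U U_1\<close>.\<close>

lemma D_F_5: "dp_D (fps_nth F 5) = dp_const (real m ^ 3 * (real l ^ 2 - real m ^ 2) / 72)
    * (dp_var 0 * dp_var 2)
    + dp_const (real m ^ 3 * (real l ^ 2 - real m ^ 2) / 72) * (dp_var 1 * dp_var 1)
    + dp_const (- (real m ^ 3 * (real m + real l) ^ 2 / 144)) * (dp_var 4)"
  (is "_ = ?Q")
proof (rule dp_eqI)
  fix v
  have "real l * dp_eval (dp_D (fps_nth F 5)) v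
      = real l * ((real m ^ 3 * (real l ^ 2 - real m ^ 2) / 72) * (v 0 * v 2)
    + (real m ^ 3 * (real l ^ 2 - real m ^ 2) / 72) * (v (Suc 0) * v (Suc 0))
    + (- (real m ^ 3 * (real m + real l) ^ 2 / 144)) * (v 4))"
      (is "_ = _ * ?E")
    using arg_cong[OF constraint_order_6, of "\<lambda>P. dp_eval P v",
        unfolded F_2 F_3 F_4 b, simplified, unfolded Suc_numerals]
    by (simp add: field_simps eval_nat_numeral)
  then have "dp_eval (dp_D (fps_nth F 5)) v = ?E"
    by (rule mult_l_cancel)
  then show "dp_eval (dp_D (fps_nth F 5)) v = dp_eval ?Q v"
    by (simp add: field_simps)
qed

text \<open>In order 7 the coefficient 5 also occurs undifferentiated, multiplied by the term of
  order 2 of \<open>u\<close>; it does so equally on both sides, so \<open>D_F_5\<close>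
  suffices.\<close>

lemma D_F_6: "dp_D (fps_nth F 6) = dp_const
    ((real m ^ 6 - 3 * real m ^ 5 * real l + 2 * real m ^ 4 * real l ^ 2) / 432)
    * (dp_var 0 * dp_var 0 * dp_var 1)
    + dp_const ((2 * real m ^ 6 + real m ^ 5 * real l - 2 * real m ^ 4 * real l ^ 2
        - real m ^ 3 * real l ^ 3) / 432) * (dp_var 0 * dp_var 3)
    + dp_const ((5 * real m ^ 6 + 3 * real m ^ 5 * real l - 5 * real m ^ 4 * real l ^ 2
        - 3 * real m ^ 3 * real l ^ 3) / 432) * (dp_var 1 * dp_var 2)
    + dp_const ((6 * real m ^ 6 + 15 * real m ^ 5 * real l + 10 * real m ^ 4 * real l ^ 2
        - real m ^ 2 * real l ^ 4) / 4320) * (dp_var 5)"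
  (is "_ = ?Q")
proof (rule dp_eqI)
  fix v
  have "real l * dp_eval (dp_D (fps_nth F 6)) v
      = real l * (((real m ^ 6 - 3 * real m ^ 5 * real l + 2 * real m ^ 4 * real l ^ 2) / 432)
          * (v 0 * v 0 * v (Suc 0))
    + ((2 * real m ^ 6 + real m ^ 5 * real l - 2 * real m ^ 4 * real l ^ 2
        - real m ^ 3 * real l ^ 3) / 432) * (v 0 * v 3)
    + ((5 * real m ^ 6 + 3 * real m ^ 5 * real l - 5 * real m ^ 4 * real l ^ 2
        - 3 * real m ^ 3 * real l ^ 3) / 432) * (v (Suc 0) * v 2)
    + ((6 * real m ^ 6 + 15 * real m ^ 5 * real l + 10 * real m ^ 4 * real l ^ 2
        - real m ^ 2 * real l ^ 4) / 4320) * (v 5))"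
      (is "_ = _ * ?E")
    using arg_cong[OF constraint_order_7, of "\<lambda>P. dp_eval P v",
        unfolded F_2 F_3 F_4 D_F_5 b, simplified, unfolded Suc_numerals]
    by (simp add: field_simps eval_nat_numeral)
  then have "dp_eval (dp_D (fps_nth F 6)) v = ?E"
    by (rule mult_l_cancel)
  then show "dp_eval (dp_D (fps_nth F 6)) v = dp_eval ?Q v"
    by (simp add: field_simps)
qed

section \<open>The right-hand side of the evolution equation\<close>

lemma dp_u_sq_nth:
  "fps_nth (dp_u b ^ 2) 0 = 1" "fps_nth (dp_u b ^ 2) 1 = 0"
  "fps_nth (dp_u b ^ 2) 2 = 2 * dp_const b * dp_var 0" "fps_nth (dp_u b ^ 2) 3 = 0"
  "fps_nth (dp_u b ^ 2) 4 = (dp_const b * dp_var 0) ^ 2"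
  "fps_nth (dp_u b ^ 2) 5 = 0" "fps_nth (dp_u b ^ 2) 6 = 0" "fps_nth (dp_u b ^ 2) 7 = 0"
  unfolding power2_eq_square[of "dp_u b"] fps_mult_nth_small[OF dp_shift_u_nth_0_1(3,4,3,4)]
  by (simp_all add: dp_u_nth power2_eq_square)

definition evol :: "real \<Rightarrow> diffpoly fps" where
  "evol a = (fps_const (dp_const a) * dp_u b) ^ 2 * (F - dp_shift (real m + real l) F)
    + dp_shift (real m) F - dp_shift (real l) F"

text \<open>With \<open>a ^ 2\<close> taken out and the difference multiplied out, every product has
  constant term 1 and no term of order 1, as \<open>fps_mult_nth_small\<close> requires.\<close>

lemma evol_nth:
  "fps_nth (evol a) k = dp_const (a ^ 2)
      * (fps_nth (dp_u b ^ 2 * F) k - fps_nth (dp_u b ^ 2 * dp_shift (real m + real l) F) k)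
    + fps_nth (dp_shift (real m) F) k - fps_nth (dp_shift (real l) F) k"
proof -
  have "evol a = fps_const (dp_const (a ^ 2))
      * (dp_u b ^ 2 * F - dp_u b ^ 2 * dp_shift (real m + real l) F)
      + dp_shift (real m) F - dp_shift (real l) F"
    by (simp add: evol_def power_mult_distrib power2_eq_square algebra_simps flip: fps_const_mult)
  then show ?thesis by simp
qed

lemmas evol_nths = evol_nth[of _ 2] evol_nth[of _ 3] evol_nth[of _ 4] evol_nth[of _ 5] evol_nth[of _ 6]

lemmas evol_nths_expanded = evol_nths[unfolded
  fps_mult_nth_small[OF dp_u_sq_nth(1,2) F(2,3)]
  fps_mult_nth_small[OF dp_u_sq_nth(1,2) dp_shift_F_nth_0_1]
  dp_shift_nth_low[OF F(2,3)] dp_u_sq_nth F_2 F_3 F_4 D_F_5 D_F_6]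

text \<open>The coefficient of \<open>a\<^sup>2\<close> is divisible by \<open>(m + l)\<^sup>2\<close>, which \<open>a (m + l) = m - l\<close> then absorbs.\<close>
lemma evol_nth_7:
  "dp_eval (fps_nth (evol a) 7) v = (a * (real m + real l)) ^ 2 *
     (- (real m ^ 5 / 432) * (v 0 * v 0 * v (Suc 0))
         - real m ^ 4 * (real m + real l) / 432 * (v 0 * v 3)
      - real m ^ 4 * (real m - real l) / 216 * (v (Suc 0) * v 2)
      - real m ^ 3 * (2 * real m ^ 2 + 2 * real m * real l - real l ^ 2) / 4320 * v 5)
    + ((real m ^ 7 - 4 * real m ^ 6 * real l + 5 * real m ^ 5 * real l ^ 2
        - 2 * real m ^ 4 * real l ^ 3) / 432 * (v 0 * v 0 * v (Suc 0))
      + (real m ^ 7 - 3 * real m ^ 6 * real l + 3 * real m ^ 5 * real l ^ 2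
          - real m ^ 4 * real l ^ 3) / 432 * (v 0 * v 3)
      + (real m ^ 7 - 4 * real m ^ 6 * real l + 5 * real m ^ 5 * real l ^ 2
          - 2 * real m ^ 4 * real l ^ 3) / 216 * (v (Suc 0) * v 2)
      + (2 * real m ^ 7 - 6 * real m ^ 6 * real l + 5 * real m ^ 5 * real l ^ 2
          - real m ^ 3 * real l ^ 4) / 4320 * v 5)"
  (is "_ = _ * ?G + ?H")
proof -
  have "dp_eval (fps_nth (dp_u b ^ 2 * F) 7) v
      - dp_eval (fps_nth (dp_u b ^ 2 * dp_shift (real m + real l) F) 7) v
    = (real m + real l) ^ 2 * ?G"
    unfolding fps_mult_nth_small[OF dp_u_sq_nth(1,2) F(2,3)]
      fps_mult_nth_small[OF dp_u_sq_nth(1,2) dp_shift_F_nth_0_1]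
      dp_shift_nth_low[OF F(2,3)] dp_u_sq_nth F_2 F_3 F_4 D_F_5 D_F_6
    unfolding b
    by (simp add: field_simps eval_nat_numeral)
  moreover have "dp_eval (fps_nth (dp_shift (real m) F) 7) v
      - dp_eval (fps_nth (dp_shift (real l) F) 7) v
    = ?H"
    unfolding dp_shift_nth_low[OF F(2,3)] F_2 F_3 F_4 D_F_5 D_F_6
    by (simp add: field_simps eval_nat_numeral)
  ultimately show ?thesis
    unfolding evol_nth by (simp add: power_mult_distrib)
qed

text \<open>The coefficient of order 7 after replacing \<open>a (m + l)\<close> by
  \<open>m - l\<close>: all four monomials share one factor, and the Sawada--Kotera polynomial is
  left.\<close>

lemma seventh_order_identity:
  fixes M L v0 v1 v2 v3 v5 :: real
  shows "(M - L) ^ 2 *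
     (- (M ^ 5 / 432) * (v0 * v0 * v1) - M ^ 4 * (M + L) / 432 * (v0 * v3)
      - M ^ 4 * (M - L) / 216 * (v1 * v2)
      - M ^ 3 * (2 * M ^ 2 + 2 * M * L - L ^ 2) / 4320 * v5)
    + ((M ^ 7 - 4 * M ^ 6 * L + 5 * M ^ 5 * L ^ 2 - 2 * M ^ 4 * L ^ 3) / 432 * (v0 * v0 * v1)
      + (M ^ 7 - 3 * M ^ 6 * L + 3 * M ^ 5 * L ^ 2 - M ^ 4 * L ^ 3) / 432 * (v0 * v3)
      + (M ^ 7 - 4 * M ^ 6 * L + 5 * M ^ 5 * L ^ 2 - 2 * M ^ 4 * L ^ 3) / 216 * (v1 * v2)
      + (2 * M ^ 7 - 6 * M ^ 6 * L + 5 * M ^ 5 * L ^ 2 - M ^ 3 * L ^ 4) / 4320 * v5)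
    = - (((M - L) ^ 2 * M ^ 4 * L) / 1080) * (v5 + 5 * v0 * v3 + 5 * v1 * v2 + 5 * v0 ^ 2 * v1)"
  by (simp add: field_simps eval_nat_numeral)

text \<open>The term of order 3 is the one that the speed \<open>c = 2 m\<close> is chosen to
  balance; the term of order 7 carries the factor \<open>a b d\<close> of the rescaled time.\<close>

lemma evol_eval:
  assumes a: "a = (real m - real l) / (real m + real l)"
    and d: "d = real m ^ 3 * (real l ^ 2 - real m ^ 2) / 180"
    and k: "k \<le> 7"
  shows "dp_eval (fps_nth (evol a) k) v =
    (if k = 3 then 2 * real m * a * b * v 1
     else if k = 7 then a * b * d * (v 5 + 5 * v 0 * v 3 + 5 * v 1 * v 2 + 5 * v 0 ^ 2 * v 1)
     else 0)"
proof -
  \<comment> \<open>Expressing \<open>m\<close> and \<open>l\<close> through their sum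
    \<open>s\<close> and \<open>a\<close> removes the quotient defining \<open>a\<close>; orders 3
    to 6 become polynomial identities in \<open>s\<close>, \<open>a\<close> and the jet.\<close>
  define s where "s = real m + real l"
  have "s > 0" using lpos by (simp add: s_def)
  then have M: "real m = s * (1 + a) / 2" and L: "real l = s * (1 - a) / 2"
    unfolding a by (simp_all add: s_def field_simps)
  have r0: "fps_nth (evol a) 0 = 0"
    using dp_u_sq_nth(1) F(2) by (simp add: evol_nth)
  have r1: "fps_nth (evol a) 1 = 0"
    unfolding evol_nth fps_mult_nth_small(2)[OF dp_u_sq_nth(1,2) F(2,3)]
      fps_mult_nth_small(2)[OF dp_u_sq_nth(1,2) dp_shift_F_nth_0_1] dp_shift_F_nth_0_1 by simp
  have r2: "dp_eval (fps_nth (evol a) 2) v = 0"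
    unfolding evol_nths_expanded by simp
  have r3: "dp_eval (fps_nth (evol a) 3) v = 2 * real m * a * b * v 1"
    unfolding evol_nths_expanded unfolding b M L by (simp add: field_simps eval_nat_numeral)
  have r4: "dp_eval (fps_nth (evol a) 4) v = 0"
    unfolding evol_nths_expanded unfolding b M L by (simp add: field_simps eval_nat_numeral)
  have r5: "dp_eval (fps_nth (evol a) 5) v = 0"
    unfolding evol_nths_expanded unfolding b M L by (simp add: field_simps eval_nat_numeral)
  have r6: "dp_eval (fps_nth (evol a) 6) v = 0"
    unfolding evol_nths_expanded unfolding b M L by (simp add: field_simps eval_nat_numeral)
  have r7: "dp_eval (fps_nth (evol a) 7) v
      = a * b * d * (v 5 + 5 * v 0 * v 3 + 5 * v (Suc 0) * v 2 + 5 * v 0 ^ 2 * v (Suc 0))"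
  proof -
    have aML: "a * (real m + real l) = real m - real l"
      using a \<open>s > 0\<close> by (simp add: s_def)
    \<comment> \<open>The factor \<open>l ^ 2 - m ^ 2\<close> of \<open>d\<close> contains the
      \<open>m + l\<close> that turns \<open>a\<close> into \<open>m - l\<close>, which produces the
      common factor of \<open>seventh_order_identity\<close>.\<close>
    have "a * b * d = (a * (real m + real l)) * (real l - real m) * (real m ^ 4 * real l) / 1080"
      by (simp add: b d power2_eq_square eval_nat_numeral field_simps)
    also have "\<dots> = - (((real m - real l) ^ 2 * real m ^ 4 * real l) / 1080)"
      unfolding aML by (simp add: power2_eq_square field_simps)
    finally show ?thesis
      unfolding evol_nth_7 aML seventh_order_identity by simp
  qed
  have "k = 0 \<or> k = 1 \<or> k = 2 \<or> k = 3 \<or> k = 4 \<or> k = 5 \<or> k = 6 \<or> k = 7"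
    using k by linarith
  then show ?thesis
    by (elim disjE) (simp_all add: r0 r1[simplified] r2 r3 r4 r5 r6 r7)
qed

end

section \<open>The time derivative and the continuous limit\<close>

lemma dt_lattice_u:
  assumes "smooth U"
  shows "dt c d (lattice_u a b U) x \<tau>
    = fps_const (c * a * b * dx U x \<tau>) * fps_X ^ 3 + fps_const (d * a * b * dtau U x \<tau>) * fps_X ^ 7"
proof -
  have u: "(\<lambda>y s. fps_nth (lattice_u a b U y s) k)
      = (if k = 0 then (\<lambda>y s. a) else if k = 2 then (\<lambda>y s. a * b * U y s) else (\<lambda>y s. 0))" for k
    by (auto simp: lattice_u_def fps_X_power_nth)
  have "dx (\<lambda>y s. a * b * U y s) x \<tau> = a * b * dx U x \<tau>"
    by (subst dx_def, rule DERIV_imp_deriv, rule DERIV_cmult, rule smooth_has_dx[OF assms])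
  then have "fps_dx (lattice_u a b U) x \<tau> = fps_const (a * b * dx U x \<tau>) * fps_X ^ 2"
    by (simp add: fps_eq_iff fps_dx_def u fps_X_power_nth) (simp add: dx_def)
  moreover have "dtau (\<lambda>y s. a * b * U y s) x \<tau> = a * b * dtau U x \<tau>"
    by (subst dtau_def, rule DERIV_imp_deriv, rule DERIV_cmult, rule smooth_has_dtau[OF assms])
  then have "fps_dtau (lattice_u a b U) x \<tau> = fps_const (a * b * dtau U x \<tau>) * fps_X ^ 2"
    by (simp add: fps_eq_iff fps_dtau_def u fps_X_power_nth) (simp add: dtau_def)
  \<comment> \<open>The \<open>\<epsilon> ^ 2\<close> in front of \<open>U\<close> meets
    \<open>c \<epsilon>\<close> and \<open>d \<epsilon> ^ 5\<close>: transport appears at order 3,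
    the slow time at order 7.\<close>
  ultimately show ?thesis
    by (simp add: dt_def eval_nat_numeral mult_ac flip: fps_const_mult)
qed

text \<open>Agreement below order \<open>n\<close> is turned into an explicit remainder, namely the
  difference divided by \<open>fps_X ^ n\<close>.\<close>

lemma fps_eq_mod_X_power:
  fixes A B :: "'a::comm_ring_1 fps"
  assumes "\<And>k. k < n \<Longrightarrow> fps_nth A k = fps_nth B k"
  shows "\<exists>R. A = B + fps_X ^ n * R"
proof -
  have "fps_cutoff n (A - B) = 0" using assms by (simp add: fps_eq_iff)
  then have "A - B = fps_X ^ n * fps_shift n (A - B)"
    using fps_shift_cutoff'[of n "A - B"] by simp
  then show ?thesis by (metis add.commute diff_add_cancel)
qed

text \<open>Unique existence of \<open>Y\<close> gives meaning to the differential polynomials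
  determined by the constraint; the error \<open>O(\<epsilon> ^ 8)\<close> is expressed by the
  cofactor \<open>R\<close>.\<close>

theorem theorem5:
  fixes m l :: nat and a b c d :: real
  assumes "m > 0" and "l > 0" and "coprime m l"
    and "a = (real m - real l) / (real m + real l)"
    and "b = real m * real l / 6"
    and "c = 2 * real m"
    and "d = real m ^ 3 * (real l ^ 2 - real m ^ 2) / 180"
  shows "(\<exists>!Y. constraint_ansatz m l b Y) \<and>
    (\<forall>Y U. constraint_ansatz m l b Y \<and> smooth U \<longrightarrow>
      (let u = lattice_u a b U; f = lattice_f Y U in \<forall>x \<tau>.
        shift m u x \<tau> * shift m f x \<tau> = u x \<tau> * shift (m + l) f x \<tau> \<and>
        (\<exists>R.
          dt c d u x \<tau>
            - ((u x \<tau>) ^ 2 * (f x \<tau> - shift (m + l) f x \<tau>) + shift m f x \<tau> - shift l f x \<tau>)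
          = fps_const (a * b * d *
              (dtau U x \<tau> - (dx ^^ 5) U x \<tau> - 5 * U x \<tau> * (dx ^^ 3) U x \<tau>
               - 5 * (dx ^^ 1) U x \<tau> * (dx ^^ 2) U x \<tau> - 5 * (U x \<tau>) ^ 2 * (dx ^^ 1) U x \<tau>))
              * fps_X ^ 7
            + fps_X ^ 8 * R)))"
proof (intro conjI allI impI)
  show "\<exists>!Y. constraint_ansatz m l b Y"
    using assms(2) by (rule constraint_ansatz_ex1)
next
  fix Y U
  assume YU: "constraint_ansatz m l b Y \<and> smooth U"
  then have U: "smooth U" by simp
  interpret sawada_kotera_constraint m l b "dp_f Y"
  proof
    show "l > 0" "b = real m * real l / 6"
      by (fact assms)+
    show "dp_constraint m l b (dp_f Y)" "fps_nth (dp_f Y) 0 = 1" "fps_nth (dp_f Y) 1 = 0"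
      using YU by (simp_all add: constraint_ansatz_iff dp_f_nth)
    show "Poly_Mapping.lookup (fps_nth (dp_f Y) k) 0 = 0" if "k > 0" for k
      using YU that by (simp add: constraint_ansatz_iff dp_f_nth)
  qed
  let ?u = "fps_const (dp_const a) * dp_u b" and ?f = "dp_f Y"
  show "let u = lattice_u a b U; f = lattice_f Y U in \<forall>x \<tau>.
        shift m u x \<tau> * shift m f x \<tau> = u x \<tau> * shift (m + l) f x \<tau> \<and>
        (\<exists>R.
          dt c d u x \<tau>
            - ((u x \<tau>) ^ 2 * (f x \<tau> - shift (m + l) f x \<tau>) + shift m f x \<tau> - shift l f x \<tau>)
          = fps_const (a * b * d *
              (dtau U x \<tau> - (dx ^^ 5) U x \<tau> - 5 * U x \<tau> * (dx ^^ 3) U x \<tau>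
               - 5 * (dx ^^ 1) U x \<tau> * (dx ^^ 2) U x \<tau> - 5 * (U x \<tau>) ^ 2 * (dx ^^ 1) U x \<tau>))
              * fps_X ^ 7
            + fps_X ^ 8 * R)"
    unfolding Let_def
  proof (intro allI conjI)
    fix x \<tau>
    note shift_simps = lattice_u_eval lattice_f_eval shift_dp_fps_eval[OF U]
    \<comment> \<open>The constant factor \<open>a\<close> commutes with shifts, so it can be
      restored on both sides of the reduced constraint.\<close>
    have "dp_shift (real m) ?u * dp_shift (real m) ?f = ?u * dp_shift (real (m + l)) ?f"
      using F(1) by (simp only: dp_constraint_def dp_shift_const_mult mult.assoc)
    then show "shift m (lattice_u a b U) x \<tau> * shift m (lattice_f Y U) x \<tau>
        = lattice_u a b U x \<tau> * shift (m + l) (lattice_f Y U) x \<tau>"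
      unfolding shift_simps by (simp only: flip: dp_fps_eval_simps)
    have rhs: "(lattice_u a b U x \<tau>) ^ 2 * (lattice_f Y U x \<tau> - shift (m + l) (lattice_f Y U) x \<tau>)
        + shift m (lattice_f Y U) x \<tau> - shift l (lattice_f Y U) x \<tau> = dp_fps_eval (evol a) (jet U x \<tau>)"
      unfolding shift_simps by (simp add: evol_def)
    show "\<exists>R. dt c d (lattice_u a b U) x \<tau>
            - ((lattice_u a b U x \<tau>) ^ 2 * (lattice_f Y U x \<tau> - shift (m + l) (lattice_f Y U) x \<tau>)
              + shift m (lattice_f Y U) x \<tau> - shift l (lattice_f Y U) x \<tau>)
          = fps_const (a * b * d *
              (dtau U x \<tau> - (dx ^^ 5) U x \<tau> - 5 * U x \<tau> * (dx ^^ 3) U x \<tau>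
               - 5 * (dx ^^ 1) U x \<tau> * (dx ^^ 2) U x \<tau> - 5 * (U x \<tau>) ^ 2 * (dx ^^ 1) U x \<tau>))
              * fps_X ^ 7
            + fps_X ^ 8 * R"
      unfolding rhs dt_lattice_u[OF U]
    proof (rule fps_eq_mod_X_power)
      fix k :: nat assume "k < 8"
      then have "dp_eval (fps_nth (evol a) k) (jet U x \<tau>) =
          (if k = 3 then c * a * b * dx U x \<tau>
           else if k = 7 then a * b * d * ((dx ^^ 5) U x \<tau> + 5 * U x \<tau> * (dx ^^ 3) U x \<tau>
             + 5 * (dx ^^ 1) U x \<tau> * (dx ^^ 2) U x \<tau> + 5 * U x \<tau> ^ 2 * (dx ^^ 1) U x \<tau>)
           else 0)"
        \<comment> \<open>By \<open>c = 2 m\<close> the coefficient of order 3 is exactly the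
          transport term of the time derivative, so the two cancel in the difference.\<close>
        using evol_eval[OF assms(4,7), of k "jet U x \<tau>"] assms(6) by (simp add: jet_def)
      then show "fps_nth (fps_const (c * a * b * dx U x \<tau>) * fps_X ^ 3
            + fps_const (d * a * b * dtau U x \<tau>) * fps_X ^ 7 - dp_fps_eval (evol a) (jet U x \<tau>)) k
          = fps_nth (fps_const (a * b * d *
              (dtau U x \<tau> - (dx ^^ 5) U x \<tau> - 5 * U x \<tau> * (dx ^^ 3) U x \<tau>
               - 5 * (dx ^^ 1) U x \<tau> * (dx ^^ 2) U x \<tau> - 5 * (U x \<tau>) ^ 2 * (dx ^^ 1) U x \<tau>))
              * fps_X ^ 7) k"
        by (simp add: fps_X_power_nth algebra_simps)
    qed
  qed
qed

end
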